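(* For every countable ordinal $\alpha$, there exist a metrizable Choquet simplex $M$ and a sequence of functions $\mathcal{H} = (h_k)$ on $M$ such that (i) $(h_k)$ is a non-decreasing sequence of harmonic, upper semi-continuous functions from $M$ to $[0,\infty)$; (ii) $\lim_k h_k$ exists and is bounded; (iii) $h_{k+1}-h_k$ is upper semi-continuous for every $k$; (iv) $\alpha_0(\mathcal{H}) = \alpha$.
   Context: A metrizable Choquet simplex is a nonempty metrizable compact convex subset $M$ of a real Hausdorff locally convex topological vector space that is a Choquet simplex, i.e. every $x\in M$ is the barycenter of a unique Borel probability measure $\mathcal{P}_x$ on $M$ with $\mathcal{P}_x(\mathrm{ex}(M))=1$, where $\mathrm{ex}(M)$ is the set of extreme points. For a Borel probability measure $\mu$ on $M$, $\mathrm{bar}(\mu)\in M$ denotes its barycenter (the point with $g(\mathrm{bar}(\mu))=\int_M g\,d\mu$ for all continuous affine $g:M\to\mathbb{R}$). A Borel function $f:M\to[0,\infty]$ is harmonic if $f(\mathrm{bar}(\mu))=\int_M f\,d\mu$ for every Borel probability measure $\mu$ on $M$. Upper semi-continuous (u.s.c.) envelope: for $f:M\to[0,\infty]$, if $f$ is bounded, $\widetilde f(x)=\inf\{g(x): g \text{ continuous}, g\ge f\}$; if $f$ is unbounded, $\widetilde f\equiv+\infty$. Order of accumulation: let $\mathcal{H}=(h_k)$ be a non-decreasing sequence of functions $h_k:M\to[0,\infty)$ with pointwise limit $h$, and let $\tau_k=h-h_k$. Define functions $u_\alpha: M\to[0,\infty]$ for all ordinals $\alpha$ by transfinite induction: $u_0\equiv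 0$; $u_{\alpha+1}=\lim_{k}\widetilde{u_\alpha+\tau_k}$; and $u_\alpha=\widetilde{\sup_{\beta<\alpha}u_\beta}$ for $\alpha$ a limit ordinal. There is a countable ordinal $\alpha$ such that $u_\beta\equiv u_\alpha$ for all $\beta\ge\alpha$; the least such ordinal is denoted $\alpha_0(\mathcal{H})$. *)

theory Defs
  imports "HOL-Probability.Probability" "HOL-Library.Function_Algebras"
    "HOL-Library.Infinite_Typeclass"
begin

section \<open>Ordinals\<close>

text \<open>
  HOL has no type of all ordinals.  The type \<open>'w ordinal\<close> consists of the order types of
  well-orders on subsets of \<open>'w\<close>, that is, of all ordinals of cardinality at most that of \<open>'w\<close>.
  It is an initial segment of the ordinals, and it contains all countable ordinals as soon as
  \<open>'w\<close> is infinite.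
\<close>

quotient_type 'w ordinal = "'w rel" / partial: "\<lambda>r s. (r, s) \<in> ordIso"
proof (rule part_equivpI)
  have "Well_order ({} :: 'w rel)"
    by simp
  then show "\<exists>r :: 'w rel. (r, r) \<in> ordIso"
    using ordIso_reflexive by blast
  show "symp (\<lambda>r s :: 'w rel. (r, s) \<in> ordIso)"
    by (auto intro: sympI ordIso_symmetric)
  show "transp (\<lambda>r s :: 'w rel. (r, s) \<in> ordIso)"
    by (auto intro: transpI ordIso_transitive)
qed

instantiation ordinal :: (type) wellorder
begin

lift_definition less_eq_ordinal :: "'a ordinal \<Rightarrow> 'a ordinal \<Rightarrow> bool"
  is "\<lambda>r s. (r, s) \<in> ordLeq"
  by (meson ordIso_ordLeq_trans ordIso_symmetric ordLeq_ordIso_trans)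

lift_definition less_ordinal :: "'a ordinal \<Rightarrow> 'a ordinal \<Rightarrow> bool"
  is "\<lambda>r s. (r, s) \<in> ordLess"
  by (meson ordIso_ordLess_trans ordIso_symmetric ordLess_ordIso_trans)

instance
proof
  fix x y z :: "'a ordinal"
  show "x < y \<longleftrightarrow> x \<le> y \<and> \<not> y \<le> x"
    by transfer (metis not_ordLess_ordLeq ordIso_iff_ordLeq ordLeq_iff_ordLess_or_ordIso)
  show "x \<le> x"
    by transfer (auto simp: ordIso_iff_ordLeq)
  show "x \<le> y \<Longrightarrow> y \<le> z \<Longrightarrow> x \<le> z"
    by transfer (rule ordLeq_transitive)
  show "x \<le> y \<Longrightarrow> y \<le> x \<Longrightarrow> x = y"
    by transfer (simp add: ordIso_iff_ordLeq)
  show "x \<le> y \<or> y \<le> x"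
    by transfer (metis ordIso_iff_ordLeq ordLeq_Well_order_simp ordLeq_total)
next
  fix P :: "'a ordinal \<Rightarrow> bool" and x
  assume *: "\<And>x. (\<And>y. y < x \<Longrightarrow> P y) \<Longrightarrow> P x"
  have rep: "\<exists>s. (s, s) \<in> ordIso \<and> y = abs_ordinal s" for y :: "'a ordinal"
    using Quotient3_rep_reflp[OF Quotient3_ordinal] Quotient3_abs_rep[OF Quotient3_ordinal, of y]
    by (intro exI[of _ "rep_ordinal y"]) simp
  have "P (abs_ordinal r)" if "(r, r) \<in> ordIso" for r :: "'a rel"
    using wf_ordLess that
  proof (induction r rule: wf_induct_rule)
    case (less r)
    show ?case
    proof (rule *)
      fix y assume y: "y < abs_ordinal r"
      obtain s where s: "(s, s) \<in> ordIso" "y = abs_ordinal s"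
        using rep[of y] by blast
      have "(s, r) \<in> ordLess"
        using y s less.prems by (simp add: less_ordinal.abs_eq)
      then show "P y"
        using less.IH s by blast
    qed
  qed
  then show "P x"
    using rep[of x] by blast
qed

end


section \<open>Metrizable Choquet simplices\<close>

text \<open>The topology of the ambient space is an explicit argument, because a type class would
  fix one topology per type.\<close>

definition hausdorff_locally_convex :: "'a::real_vector topology \<Rightarrow> bool" where
  "hausdorff_locally_convex T \<longleftrightarrow>
     topspace T = UNIV \<and> Hausdorff_space T \<and>
     continuous_map (prod_topology T T) T (\<lambda>(x, y). x + y) \<and>
     continuous_map (prod_topology euclideanreal T) T (\<lambda>(c, x). c *\<^sub>R x) \<and>
     (\<forall>U. openin T U \<and> 0 \<in> U \<longrightarrow> (\<exists>V. openin T V \<and> 0 \<in> V \<and> convex V \<and> V \<subseteq> U))"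

definition borel_of :: "'a topology \<Rightarrow> 'a measure" where
  "borel_of X = sigma (topspace X) {U. openin X U}"

definition borel_prob :: "'a topology \<Rightarrow> 'a measure \<Rightarrow> bool" where
  "borel_prob X \<mu> \<longleftrightarrow> prob_space \<mu> \<and> sets \<mu> = sets (borel_of X)"

definition affine_map_on :: "'a::real_vector set \<Rightarrow> ('a \<Rightarrow> real) \<Rightarrow> bool" where
  "affine_map_on M g \<longleftrightarrow>
     (\<forall>x\<in>M. \<forall>y\<in>M. \<forall>t\<in>{0..1}. g ((1 - t) *\<^sub>R x + t *\<^sub>R y) = (1 - t) * g x + t * g y)"

text \<open>In the following definitions \<open>X\<close> is the compact convex set \<open>M = topspace X\<close> with its subspace
  topology.  On such a set every Borel probability measure has exactly one barycenter, so the
  relation below is the graph of the map \<open>bar\<close>.\<close>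

definition is_barycenter :: "'a::real_vector topology \<Rightarrow> 'a measure \<Rightarrow> 'a \<Rightarrow> bool" where
  "is_barycenter X \<mu> x \<longleftrightarrow> x \<in> topspace X \<and>
     (\<forall>g. continuous_map X euclideanreal g \<and> affine_map_on (topspace X) g
        \<longrightarrow> g x = (\<integral>y. g y \<partial>\<mu>))"

definition metrizable_Choquet_simplex :: "'a::real_vector topology \<Rightarrow> 'a set \<Rightarrow> bool" where
  "metrizable_Choquet_simplex T M \<longleftrightarrow>
     hausdorff_locally_convex T \<and>
     M \<noteq> {} \<and> compactin T M \<and> convex M \<and> metrizable_space (subtopology T M) \<and>
     (\<forall>x\<in>M. \<exists>!\<mu>. borel_prob (subtopology T M) \<mu> \<and> is_barycenter (subtopology T M) \<mu> x \<and>
        emeasure \<mu> {y. y extreme_point_of M} = 1)"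

definition harmonic :: "'a::real_vector topology \<Rightarrow> ('a \<Rightarrow> ennreal) \<Rightarrow> bool" where
  "harmonic X f \<longleftrightarrow> f \<in> borel_measurable (borel_of X) \<and>
     (\<forall>\<mu> x. borel_prob X \<mu> \<and> is_barycenter X \<mu> x \<longrightarrow> f x = (\<integral>\<^sup>+y. f y \<partial>\<mu>))"


section \<open>Order of accumulation\<close>

definition usc :: "'a topology \<Rightarrow> ('a \<Rightarrow> ennreal) \<Rightarrow> bool" where
  "usc X f \<longleftrightarrow> (\<forall>c. openin X {x \<in> topspace X. f x < c})"

definition bounded_on :: "'a set \<Rightarrow> ('a \<Rightarrow> ennreal) \<Rightarrow> bool" where
  "bounded_on M f \<longleftrightarrow> (\<exists>B::real. \<forall>x\<in>M. f x \<le> ennreal B)"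

text \<open>The coercion \<open>ennreal\<close> truncates negative reals to \<open>0\<close>, so \<open>g \<ge> f\<close> is
  \<open>0 \<le> g y \<and> f y \<le> ennreal (g y)\<close>.\<close>

definition usc_envelope :: "'a topology \<Rightarrow> ('a \<Rightarrow> ennreal) \<Rightarrow> 'a \<Rightarrow> ennreal" where
  "usc_envelope X f x =
     (if bounded_on (topspace X) f
      then INF g\<in>{g. continuous_map X euclideanreal g \<and>
                    (\<forall>y\<in>topspace X. 0 \<le> g y \<and> f y \<le> ennreal (g y))}. ennreal (g x)
      else \<top>)"

definition tail :: "(nat \<Rightarrow> 'a \<Rightarrow> ennreal) \<Rightarrow> nat \<Rightarrow> 'a \<Rightarrow> ennreal" where
  "tail h k x = lim (\<lambda>j. h j x) - h k x"

text \<open>The sequence \<open>u\<^sub>\<alpha>\<close>.  In the second case \<open>\<alpha>\<close> is the successor of the greatest \<open>\<beta> < \<alpha>\<close>.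
  Only the values on \<open>topspace X\<close> are meaningful.\<close>

function accum :: "'a topology \<Rightarrow> (nat \<Rightarrow> 'a \<Rightarrow> ennreal) \<Rightarrow> 'o::wellorder \<Rightarrow> 'a \<Rightarrow> ennreal" where
  "accum X h \<alpha> =
     (if {..<\<alpha>} = {} then (\<lambda>x. 0)
      else if \<exists>\<beta><\<alpha>. \<forall>\<gamma><\<alpha>. \<gamma> \<le> \<beta>
      then (\<lambda>x. lim (\<lambda>k. usc_envelope X (\<lambda>y. accum X h (GREATEST \<beta>. \<beta> < \<alpha>) y + tail h k y) x))
      else usc_envelope X (\<lambda>y. SUP \<beta>\<in>{..<\<alpha>}. accum X h \<beta> y))"
  by auto
termination
proof (relation "inv_image {(\<alpha>, \<beta>). \<alpha> < \<beta>} (\<lambda>(X, h, \<alpha>). \<alpha>)", goal_cases)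
  case 1
  show ?case
    by (rule wf_inv_image[OF wf])
next
  case (2 X h \<alpha>)
  then obtain \<beta> where "\<beta> < \<alpha>" "\<forall>\<gamma><\<alpha>. \<gamma> \<le> \<beta>"
    by blast
  then have "(GREATEST \<beta>. \<beta> < \<alpha>) = \<beta>"
    by (intro Greatest_equality) auto
  with \<open>\<beta> < \<alpha>\<close> show ?case
    by simp
qed auto

declare accum.simps [simp del]

definition accumulation_order :: "'a topology \<Rightarrow> (nat \<Rightarrow> 'a \<Rightarrow> ennreal) \<Rightarrow> 'o::wellorder" where
  "accumulation_order X h =
     (LEAST \<alpha>. \<forall>\<beta>\<ge>\<alpha>. \<forall>x\<in>topspace X. accum X h \<beta> x = accum X h \<alpha> x)"


section \<open>The vector space of real sequences\<close>

text \<open>HOL cannot quantify existentially over the ambient vector space, so a concrete one is needed.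
  Real sequences lose no generality: a metrizable compact convex subset of a Hausdorff locally
  convex space has a countable family of continuous affine functions that separates its points,
  and hence is affinely homeomorphic to a subset of \<open>nat \<Rightarrow> real\<close> with the product topology.\<close>

instantiation "fun" :: (type, real_vector) real_vector
begin

definition scaleR_fun :: "real \<Rightarrow> ('a \<Rightarrow> 'b) \<Rightarrow> 'a \<Rightarrow> 'b" where
  "scaleR_fun c f = (\<lambda>x. c *\<^sub>R f x)"

instance
  by standard (auto simp: scaleR_fun_def fun_eq_iff algebra_simps)

end

end

theory Submission
  imports Defs "HOL-Library.Multiset_Order" "HOL-Library.Sublist" "HOL-Library.Nat_Bijection"
begin

text \<open>
  Let a countable well-founded tree of finite sequences carry the topology in which the set of
  descendants of each node is open and closed and the children \<open>n # s\<close> of a node \<open>s\<close> converge to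
  \<open>s\<close>.  This space is compact, and the probability measures on it form a metrizable Choquet simplex
  whose extreme points are the nodes.  Give each node \<open>s\<close> a bump \<open>b s \<ge> 0\<close>, and let \<open>H k\<close> be the
  harmonic extension of \<open>b\<close> restricted to the nodes with code below \<open>k\<close>.  A function with finite
  support on closed points is upper semicontinuous, so \<open>H\<close> has all the required regularity.  Its tails
  are the bumps with large code.  Near a node \<open>s\<close>, all nodes other than \<open>s\<close> have large codes, and
  therefore the index \<open>k\<close> disappears from the recursion: on nodes, \<open>u\<^sub>\<gamma>\<^sub>+\<^sub>1(s)\<close> is the limes superior,
  as \<open>n\<close> grows, of the supremum of \<open>u\<^sub>\<gamma> + b\<close> over the descendants of \<open>n # s\<close>.  Thus \<open>u\<^sub>\<gamma>(s)\<close> is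
  what a player can collect who starts at \<open>s\<close> with an ordinal clock \<open>\<gamma>\<close>: in each move an adversary
  names a number, the player jumps to a descendant through a child beyond that number and sets the
  clock to a smaller ordinal.  The bump of the target is paid if the clock was a successor; at a limit
  the player pays only for the right to choose the new clock after seeing the adversary's number.

  The tree must be such that the clock \<open>\<alpha>\<close>, and no smaller one, collects everything.  Its nodes are
  the positions of a hydra game.  A position is a list of blocks \<open>(d, B)\<close> with an ordinal exponent \<open>d\<close>
  and a budget \<open>B\<close>; the block with the least exponent is played first.  A block of exponent \<open>0\<close> pays
  its budget and vanishes.  A block of exponent \<open>d > 0\<close> breaks into \<open>N\<close> blocks of a smaller
  exponent, each with budget \<open>B / N\<close>, where \<open>N\<close> is at least the number of the chosen child.  The rank
  of a position is the multiset of its exponents, to be read as the natural sum of the powers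
  \<open>\<omega>\<^sup>d\<close>; multisets are well-ordered accordingly, and \<open>clock\<close> identifies the ordinals with an
  initial segment of them.  The clock \<open>rank s\<close> collects the whole budget of \<open>s\<close>, because the rank
  decreases in every move.  A smaller clock \<open>C\<close> cannot: a block which it cannot afford completely is
  cut into so many pieces that those it can afford are almost worthless.  So \<open>C\<close> collects at most
  \<open>gain s C\<close>, the largest budget of a set of blocks of \<open>s\<close> whose rank is at most \<open>C\<close>.

  The weight of the argument lies in four facts.  \<open>gain_upper_semicontinuous\<close> is the last claim, about
  the game alone.  \<open>accum_le\<close> and \<open>accum_ge\<close> turn a family of functions on the nodes that respects the
  moves into an upper or lower bound for the transfinite sequence on the whole simplex.
  \<open>metrizable_Choquet_simplex\<close> is the geometry.  At the root, \<open>gain\<close> is strictly below the total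
  budget for clocks below \<open>\<alpha>\<close>, and from \<open>\<alpha>\<close> on both bounds agree with the total budget at every
  node; hence \<open>accumulation_order_eq\<close>.
\<close>

section \<open>Multisets of ordinals as a clock\<close>

definition zero_elt :: "'d::wellorder" where
  "zero_elt = (LEAST x. True)"

lemma zero_elt_le [simp]: "zero_elt \<le> x"
  unfolding zero_elt_def by (rule Least_le) simp

lemma not_less_zero_elt [simp]: "\<not> x < zero_elt"
  by (simp add: not_less)

text \<open>
  Adding the least element is the successor operation of the multiset order: the smallest way of
  increasing a multiset leaves all other multiplicities alone.
\<close>
lemma add_zero_elt_le:
  fixes M M' :: "'d::wellorder multiset"
  assumes "M < M'"
  shows "add_mset zero_elt M \<le> M'"
  unfolding less_eq_multiset\<^sub>H\<^sub>O
proof (intro allI impI)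
  fix y assume y: "count M' y < count (add_mset zero_elt M) y"
  have *: "M \<noteq> M'" "\<And>y. count M' y < count M y \<Longrightarrow> \<exists>x>y. count M x < count M' x"
    using assms unfolding less_multiset\<^sub>H\<^sub>O by auto
  have "\<exists>x>y. count M x < count M' x"
  proof (cases "count M' y < count M y")
    case False
    then have [simp]: "y = zero_elt" and eq: "count M' y = count M y"
      using y by (auto split: if_splits)
    obtain x where x: "count M x \<noteq> count M' x"
      using *(1) by (meson multiset_eqI)
    then have "x \<noteq> zero_elt" using eq by auto
    then have "x > zero_elt" by (simp add: order_less_le)
    then show ?thesis
      using x *(2)[of x] by (metis \<open>y = zero_elt\<close> linorder_neqE_nat order_less_trans)
  qed (use * in auto)
  then obtain x where "x > y" "count M x < count M' x" by auto
  then show "\<exists>x>y. count (add_mset zero_elt M) x < count M' x"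
    by (metis count_add_mset not_less_zero_elt)
qed

text \<open>
  The order isomorphism of the ordinals with an initial segment of the multisets.  The set over which
  \<open>LEAST\<close> ranges is never empty, because the singletons \<open>{#\<gamma>#}\<close> already form an increasing sequence.
\<close>
function clock :: "'o::wellorder \<Rightarrow> 'o multiset" where
  "clock \<gamma> = (LEAST M. \<forall>\<beta><\<gamma>. clock \<beta> < M)"
  by auto
termination by (relation "{(x, y). x < y}") (auto intro: wf)

declare clock.simps [simp del]

lemma clock_le_single: "clock \<gamma> \<le> {#\<gamma>#}"
proof (induction \<gamma> rule: less_induct)
  case (less \<gamma>)
  then have "\<forall>\<beta><\<gamma>. clock \<beta> < {#\<gamma>#}"
    by (meson mset_lt_single_iff order_le_less_trans)
  then show ?case
    by (subst clock.simps) (rule Least_le)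
qed

lemma clock_strict_mono: "\<beta> < \<gamma> \<Longrightarrow> clock \<beta> < clock \<gamma>"
proof -
  assume "\<beta> < \<gamma>"
  have "\<forall>\<beta><\<gamma>. clock \<beta> < {#\<gamma>#}"
    by (meson mset_lt_single_iff order_le_less_trans clock_le_single)
  then have "\<forall>\<beta><\<gamma>. clock \<beta> < clock \<gamma>"
    by (subst (2) clock.simps) (rule LeastI)
  with \<open>\<beta> < \<gamma>\<close> show ?thesis by auto
qed

lemma clock_less_iff [simp]: "clock \<beta> < clock \<gamma> \<longleftrightarrow> \<beta> < \<gamma>"
  by (metis clock_strict_mono less_asym linorder_neqE)

lemma clock_le_iff [simp]: "clock \<beta> \<le> clock \<gamma> \<longleftrightarrow> \<beta> \<le> \<gamma>"
  by (metis clock_less_iff linorder_not_le)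

text \<open>
  The image of \<open>clock\<close> is an initial segment, so every multiset below \<open>clock \<gamma>\<close> is itself the time
  shown by an earlier clock.
\<close>
lemma less_clockE:
  assumes "M < clock \<gamma>"
  obtains \<beta> where "\<beta> < \<gamma>" "M = clock \<beta>"
proof -
  have "\<not> (\<forall>\<beta><\<gamma>. clock \<beta> < M)"
    using assms by (subst (asm) clock.simps) (rule not_less_Least)
  then have ex: "\<exists>\<beta>. \<beta> < \<gamma> \<and> M \<le> clock \<beta>"
    by (auto simp: not_less)
  define \<beta> where "\<beta> = (LEAST \<beta>. M \<le> clock \<beta>)"
  have le: "M \<le> clock \<beta>"
    unfolding \<beta>_def using ex by (metis (mono_tags, lifting) LeastI)
  have "\<beta> < \<gamma>"
    unfolding \<beta>_def using ex by (metis (mono_tags, lifting) Least_le order_le_less_trans)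
  moreover have "\<forall>\<beta>'<\<beta>. clock \<beta>' < M"
    unfolding \<beta>_def using not_less_Least by (metis (mono_tags, lifting) linorder_not_le)
  then have "clock \<beta> \<le> M"
    by (subst clock.simps) (rule Least_le)
  ultimately show ?thesis
    using le that by (metis order_antisym)
qed

section \<open>A hydra game with budgets\<close>

text \<open>
  A state lists the blocks that are still alive, each with its exponent and its budget.
\<close>
type_synonym 'd state = "('d \<times> real) list"

definition rank :: "'d state \<Rightarrow> 'd multiset" where
  "rank s = image_mset fst (mset s)"

definition budget :: "('d \<times> real) multiset \<Rightarrow> real" where
  "budget J = (\<Sum>x\<in>#J. snd x)"

lemma budget_simps [simp]:
  "budget {#} = 0" "budget (add_mset x J) = snd x + budget J"
  "budget (J + K) = budget J + budget K"
  by (auto simp: budget_def)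

lemma budget_replicate [simp]: "budget (replicate_mset n x) = n * snd x"
  by (induction n) (auto simp: algebra_simps)

lemma budget_nonneg: "(\<And>x. x \<in># J \<Longrightarrow> 0 \<le> snd x) \<Longrightarrow> 0 \<le> budget J"
  by (induction J) auto

lemma budget_mono:
  assumes "J \<subseteq># K" "\<And>x. x \<in># K \<Longrightarrow> 0 \<le> snd x"
  shows "budget J \<le> budget K"
proof -
  obtain R where "K = J + R" using assms(1) by (metis subset_mset.le_iff_add)
  with assms(2) show ?thesis using budget_nonneg[of R] by auto
qed

definition affordable :: "'d::preorder state \<Rightarrow> 'd multiset \<Rightarrow> ('d \<times> real) multiset set" where
  "affordable s C = {J. J \<subseteq># mset s \<and> image_mset fst J \<le> C}"

text \<open>
  What a player with clock \<open>C\<close> can secure in position \<open>s\<close>.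
\<close>
definition gain :: "'d::preorder state \<Rightarrow> 'd multiset \<Rightarrow> real" where
  "gain s C = Max (budget ` affordable s C)"

lemma finite_affordable [simp]: "finite (affordable s C)"
proof (rule finite_subset)
  show "affordable s C \<subseteq> mset ` {xs. set xs \<subseteq> set s \<and> length xs \<le> length s}"
  proof
    fix J assume "J \<in> affordable s C"
    then have J: "J \<subseteq># mset s" by (simp add: affordable_def)
    obtain xs where xs: "mset xs = J" using ex_mset by blast
    have "set xs \<subseteq> set s" "length xs \<le> length s"
      using J xs set_mset_mono[OF J] size_mset_mono[OF J] by (auto simp flip: size_mset)
    then show "J \<in> mset ` {xs. set xs \<subseteq> set s \<and> length xs \<le> length s}"
      using xs by blast
  qed
qed (auto intro: finite_lists_length_le)

lemmas finite_budget_affordable [simp] = finite_imageI[OF finite_affordable, of budget]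

lemma empty_affordable [simp]: "{#} \<in> affordable s C"
  by (simp add: affordable_def)

lemma gain_nonneg: "0 \<le> gain s C"
  unfolding gain_def using empty_affordable[of s C] budget_simps(1)
  by (metis Max_ge finite_affordable finite_imageI imageI)

lemma gain_geI: "J \<subseteq># mset s \<Longrightarrow> image_mset fst J \<le> C \<Longrightarrow> budget J \<le> gain s C"
  unfolding gain_def by (rule Max_ge) (simp, simp add: affordable_def)

lemma gain_leI:
  assumes "\<And>J. J \<subseteq># mset s \<Longrightarrow> image_mset fst J \<le> C \<Longrightarrow> budget J \<le> v"
  shows "gain s C \<le> v"
proof -
  have "budget ` affordable s C \<noteq> {}" using empty_affordable[of s C] by blast
  then show ?thesis
    unfolding gain_def using assms by (subst Max_le_iff) (simp, simp, simp add: affordable_def)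
qed

lemma gain_lessI:
  assumes "\<And>J. J \<subseteq># mset s \<Longrightarrow> image_mset fst J \<le> C \<Longrightarrow> budget J < v"
  shows "gain s C < v"
proof -
  have "budget ` affordable s C \<noteq> {}" using empty_affordable[of s C] by blast
  then show ?thesis
    unfolding gain_def using assms by (subst Max_less_iff) (simp, simp, simp add: affordable_def)
qed

lemma gain_mono: "C \<le> C' \<Longrightarrow> gain s C \<le> gain s C'"
  by (intro gain_leI gain_geI) auto

lemma gain_le_budget: "(\<And>x. x \<in> set s \<Longrightarrow> 0 \<le> snd x) \<Longrightarrow> gain s C \<le> budget (mset s)"
  by (intro gain_leI budget_mono) auto

lemma gain_eq_budget:
  assumes "\<And>x. x \<in> set s \<Longrightarrow> 0 \<le> snd x" "rank s \<le> C"
  shows "gain s C = budget (mset s)"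
  using gain_le_budget[of s C, OF assms(1)] gain_geI[of "mset s" s C] assms(2)
  by (auto simp: rank_def intro: order_antisym)

text \<open>
  A clock below the rank has to leave out at least one block, and all blocks are worth something.
\<close>
lemma gain_less_budget:
  fixes s :: "'d::linorder state"
  assumes "\<And>x. x \<in> set s \<Longrightarrow> 0 < snd x" "C < rank s"
  shows "gain s C < budget (mset s)"
proof (rule gain_lessI)
  fix J assume J: "J \<subseteq># mset s" "image_mset fst J \<le> C"
  then obtain R where R: "mset s = J + R" by (metis subset_mset.le_iff_add)
  have "R \<noteq> {#}"
    using J(2) assms(2) R by (auto simp: rank_def)
  then obtain x R' where "R = add_mset x R'" by (meson multiset_cases)
  moreover have "\<And>x. x \<in># R \<Longrightarrow> 0 < snd x"
    using assms(1) R by (metis set_mset_mset union_iff)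
  ultimately show "budget J < budget (mset s)"
    using R budget_nonneg[of R'] by (auto simp: add_pos_nonneg less_imp_le)
qed

text \<open>
  In the order of ordinals: if \<open>\<omega>\<^sup>d\<close> is at most every term of a sum \<open>A\<close>, and \<open>C\<close> lies between \<open>A\<close> and
  \<open>A + \<omega>\<^sup>d\<close>, then \<open>A\<close> is an initial part of the Cantor normal form of \<open>C\<close>.  The proof compares
  multiplicities at the largest element where the two multisets differ.
\<close>
lemma mset_filter_if_squeezed:
  fixes A C :: "'d::linorder multiset"
  assumes "A + M \<le> C" "C < add_mset d A" "\<And>a. a \<in># A \<Longrightarrow> d \<le> a"
  shows "filter_mset (\<lambda>c. d \<le> c) C = A"
proof (rule ccontr)
  define Y where "Y = {y. d \<le> y \<and> count C y \<noteq> count A y}"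
  assume "filter_mset (\<lambda>c. d \<le> c) C \<noteq> A"
  then obtain y where "count (filter_mset (\<lambda>c. d \<le> c) C) y \<noteq> count A y"
    by (meson multiset_eqI)
  then have "y \<in> Y"
    using assms(3)[of y] by (auto simp: Y_def count_eq_zero_iff split: if_splits)
  moreover have "Y \<subseteq> set_mset C \<union> set_mset A"
    by (auto simp: Y_def) (metis count_inI)
  then have "finite Y" by (rule finite_subset) auto
  ultimately obtain m where m: "m \<in> Y" "\<And>y. y \<in> Y \<Longrightarrow> y \<le> m"
    by (metis Max_ge Max_in emptyE)
  have above: "count C y = count A y" if "y > m" for y
  proof (rule ccontr)
    assume "count C y \<noteq> count A y"
    then have "y \<in> Y" using that m(1) by (auto simp: Y_def)
    then show False using m(2) that by force
  qed
  have m': "d \<le> m" "count C m \<noteq> count A m" using m by (auto simp: Y_def)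
  show False
  proof (cases "count C m < count A m")
    case True
    then have "\<exists>x>m. count (A + M) x < count C x"
      using assms(1) unfolding less_eq_multiset\<^sub>H\<^sub>O by auto
    then show False using above by auto
  next
    case False
    then have gt: "count A m < count C m" using m' by auto
    have "add_mset d A \<le> C"
      unfolding less_eq_multiset\<^sub>H\<^sub>O
    proof (intro allI impI)
      fix y assume y: "count C y < count (add_mset d A) y"
      have "y < m"
      proof (rule ccontr)
        assume "\<not> y < m"
        then consider "y > m" | "y = m" by force
        then show False using y above[of y] gt m' by cases (auto split: if_splits)
      qed
      moreover have "count (add_mset d A) m < count C m \<or> m = d \<and> y < d"
        using gt m' \<open>y < m\<close> by auto
      moreover have "\<not> y < d"
        using y assms(3)[of y] not_in_iff[of y A] by (auto split: if_splits)
      ultimately show "\<exists>x>y. count (add_mset d A) x < count C x" by blast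
    qed
    with assms(2) show False by auto
  qed
qed

text \<open>
  If all exponents of \<open>R\<close> are at most \<open>r\<close>, then a time of rank \<open>R\<close> cannot afford more than \<open>size R\<close>
  blocks of exponent \<open>r\<close> or more, whatever \<open>R\<close> is in detail.  This is what bounds the number of
  pieces of a broken block that can be paid.
\<close>
lemma size_le_if_mset_le:
  fixes M R :: "'d::linorder multiset"
  assumes "M \<le> R" "\<And>x. x \<in># R \<Longrightarrow> x \<le> r"
  shows "size (filter_mset (\<lambda>x. r \<le> x) M) \<le> size R"
proof (rule ccontr)
  define Q where "Q = filter_mset (\<lambda>x. r \<le> x) M"
  assume "\<not> size (filter_mset (\<lambda>x. r \<le> x) M) \<le> size R"
  then have lt: "size R < size Q" by (simp add: Q_def)
  have "Q \<le> R"
    using assms(1) subset_eq_imp_le_multiset[of Q M] by (auto simp: Q_def intro: order_trans)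
  moreover have "R < Q"
  proof (cases "\<exists>x. x \<in># Q \<and> r < x")
    case True
    then show ?thesis using assms(2) by (intro ex_gt_imp_less_multiset) force
  next
    case False
    then have Q: "Q = replicate_mset (size Q) r"
      by (intro set_mset_subset_singletonD) (force simp: Q_def not_less)
    have r: "count R r < count Q r"
      using lt Q by (metis count_replicate_mset count_le_size order_le_less_trans)
    show ?thesis unfolding less_multiset\<^sub>H\<^sub>O
    proof (intro conjI allI impI)
      show "R \<noteq> Q" using lt by auto
      fix y assume "count Q y < count R y"
      then have "y \<le> r" "y \<noteq> r"
        using assms(2)[of y] r by (auto simp: count_inI)
      then show "\<exists>x>y. count R x < count Q x" using r by (auto intro!: exI[of _ r])
    qed
  qed
  ultimately show False by auto
qed


text \<open>
  \<open>fund N d\<close> is the \<open>N\<close>-th term of a fundamental sequence of \<open>d\<close>.  The second assumption asks for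
  uniformity in \<open>d\<close>: from some index on, the terms for all \<open>d > e\<close> up to
  \<open>bound\<close> are at least \<open>e\<close>.
  Without it, a block could drop below \<open>e\<close> through a chain of different limit ordinals while it is
  broken into few pieces only.
\<close>
locale hydra =
  fixes fund :: "nat \<Rightarrow> 'd::wellorder \<Rightarrow> 'd" and bound :: 'd
  assumes fund_less: "zero_elt < d \<Longrightarrow> fund N d < d"
    and fund_cofinal: "e < bound \<Longrightarrow> \<exists>N0. \<forall>N\<ge>N0. \<forall>d. e < d \<and> d \<le> bound \<longrightarrow> e \<le> fund N d"
begin

fun step :: "nat \<Rightarrow> 'd state \<Rightarrow> 'd state" where
  "step N [] = []"
| "step N ((d, B) # r) = (if d = zero_elt then r else replicate N (fund N d, B / real N) @ r)"

text \<open>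
  Sortedness says that a block is played only after all blocks of smaller exponent are gone.
\<close>
definition good :: "'d state \<Rightarrow> bool" where
  "good s \<longleftrightarrow> sorted (map fst s) \<and> (\<forall>x\<in>set s. 0 \<le> snd x \<and> fst x \<le> bound)"

lemma good_Cons: "good ((d, B) # r) \<longleftrightarrow> 0 \<le> B \<and> d \<le> bound \<and> (\<forall>x\<in>set r. d \<le> fst x) \<and> good r"
  by (auto simp: good_def)

lemma pos_if_not_zero_elt: "d \<noteq> zero_elt \<Longrightarrow> zero_elt < d"
  by (simp add: order_less_le)

lemma good_step: "good s \<Longrightarrow> good (step N s)"
proof (induction N s rule: step.induct)
  case (2 N d B r)
  show ?case
  proof (cases "d = zero_elt")
    case False
    then have "fund N d < d" by (intro fund_less pos_if_not_zero_elt)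
    with 2 False show ?thesis
      by (fastforce simp: good_def sorted_append)
  qed (use 2 in \<open>auto simp: good_Cons\<close>)
qed auto

lemma budget_step:
  "s \<noteq> [] \<Longrightarrow> 1 \<le> N \<Longrightarrow>
    budget (mset s) = budget (mset (step N s)) + (if fst (hd s) = zero_elt then snd (hd s) else 0)"
  by (cases "(N, s)" rule: step.cases) auto

lemma rank_step_less: "s \<noteq> [] \<Longrightarrow> rank (step N s) < rank s"
proof (induction N s rule: step.induct)
  case (2 N d B r)
  have "replicate_mset N (fund N d) < {#d#}" if "d \<noteq> zero_elt"
    using fund_less[OF pos_if_not_zero_elt[OF that]] by (auto simp: in_replicate_mset)
  then show ?case
    by (auto simp: rank_def)
qed auto

inductive reach :: "nat \<Rightarrow> 'd state \<Rightarrow> 'd state \<Rightarrow> bool" for N s where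
  refl: "reach N s s"
| step: "reach N s t \<Longrightarrow> N \<le> N' \<Longrightarrow> reach N s (step N' t)"

lemma reach_good: "reach N s t \<Longrightarrow> good s \<Longrightarrow> good t"
  by (induction rule: reach.induct) (auto intro: good_step)

lemma reach_budget: "reach N s t \<Longrightarrow> 1 \<le> N \<Longrightarrow> good s \<Longrightarrow> budget (mset t) \<le> budget (mset s)"
proof (induction rule: reach.induct)
  case (step t N')
  show ?case
  proof (cases "t = []")
    case False
    have "good t" using step by (auto intro: reach_good)
    then have "0 \<le> snd (hd t)" using False by (auto simp: good_def)
    then show ?thesis using budget_step[OF False, of N'] step by (auto split: if_splits)
  qed (use step in auto)
qed auto

lemma step_append: "K \<noteq> [] \<Longrightarrow> step N (K @ r) = step N K @ r"
  by (cases "(N, K)" rule: step.cases) auto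

text \<open>
  The list acts as a stack: the tail \<open>r\<close> stays untouched until everything above it has been played.
\<close>
lemma reach_append:
  "reach N (K @ r) t \<Longrightarrow> (\<exists>K'. reach N K K' \<and> t = K' @ r) \<or> reach N r t"
proof (induction rule: reach.induct)
  case refl
  then show ?case by (auto intro: reach.refl)
next
  case (step t N')
  from step.IH show ?case
  proof (elim disjE exE conjE)
    fix K' assume K': "reach N K K'" "t = K' @ r"
    show ?thesis
    proof (cases "K' = []")
      case True
      then show ?thesis using K' step.hyps by (auto intro: reach.intros)
    next
      case False
      then show ?thesis using K' step.hyps by (auto simp: step_append intro!: reach.intros)
    qed
  qed (use step.hyps in \<open>auto intro: reach.intros\<close>)
qed

text \<open>
  One more tick of the clock pays for a block of exponent zero.
\<close>
lemma gain_step_zero: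
  assumes "s \<noteq> []" "fst (hd s) = zero_elt" "add_mset zero_elt C \<le> C'"
  shows "gain (step N s) C + snd (hd s) \<le> gain s C'"
proof -
  obtain B r where s: "s = (zero_elt, B) # r"
    using assms by (cases s) auto
  have "gain r C \<le> gain s C' - B"
  proof (rule gain_leI)
    fix J assume J: "J \<subseteq># mset r" "image_mset fst J \<le> C"
    have "budget (add_mset (zero_elt, B) J) \<le> gain s C'"
      using J assms(3) by (intro gain_geI) (auto simp: s intro: order_trans[OF add_mset_le_right_le])
    then show "budget J \<le> gain s C' - B" by auto
  qed
  then show ?thesis by (auto simp: s)
qed

definition low :: "'d \<Rightarrow> 'd state \<Rightarrow> real" where
  "low r K = budget (filter_mset (\<lambda>x. fst x < r) (mset K))"

lemma low_simps [simp]: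
  "low r [] = 0" "low r (x # K) = (if fst x < r then snd x else 0) + low r K"
  "low r (K @ K') = low r K + low r K'"
  "low r (replicate n x) = (if fst x < r then n * snd x else 0)"
proof -
  show "low r (replicate n x) = (if fst x < r then n * snd x else 0)"
    by (induction n) (auto simp: low_def algebra_simps)
qed (auto simp: low_def)

lemma low_eq_0: "\<forall>x\<in>set K. r \<le> fst x \<Longrightarrow> low r K = 0"
  by (induction K) auto

text \<open>
  Once \<open>(d, B)\<close> is broken, every piece has budget at most \<open>B / N\<close>.  The pieces of the first break have
  exponent at least \<open>r\<close>.  Pieces of exponent below \<open>r\<close> arise only when a piece of exponent exactly \<open>r\<close>
  breaks, and they are all played before another piece of exponent \<open>r\<close> or more is touched.  So at any
  time they come from a single piece, and even their total budget is at most \<open>B / N\<close>.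
\<close>
lemma low_fragments:
  assumes "reach N [(d, B)] K" "1 \<le> N" "r < d" "good [(d, B)]"
    and cof: "\<And>N' d. N \<le> N' \<Longrightarrow> r < d \<Longrightarrow> d \<le> bound \<Longrightarrow> r \<le> fund N' d"
  shows "K = [(d, B)] \<or> (\<forall>x\<in>set K. snd x \<le> B / N) \<and> low r K \<le> B / N"
  using assms(1)
proof (induction rule: reach.induct)
  case (step K N')
  have B: "0 \<le> B" using assms(4) by (auto simp: good_def)
  have N': "1 \<le> N'" "N \<le> N'" using step assms(2) by auto
  from step.IH show ?case
  proof (elim disjE conjE)
    assume K: "K = [(d, B)]"
    have "r \<le> fund N' d" using cof step assms by (auto simp: good_def)
    moreover have "B / N' \<le> B / N" using B N' assms(2) by (intro divide_left_mono) auto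
    moreover have "d \<noteq> zero_elt" using \<open>r < d\<close> by auto
    ultimately show ?thesis using K B by (auto simp: not_less)
  next
    assume K: "\<forall>x\<in>set K. snd x \<le> B / N" "low r K \<le> B / N"
    have gK: "good K" using step assms by (auto intro: reach_good)
    show ?thesis
    proof (cases "(N', K)" rule: step.cases)
      case (2 N'' e b K')
      then have K': "K = (e, b) # K'" and [simp]: "N'' = N'" by auto
      have b: "0 \<le> b" "b \<le> B / N" "e \<le> bound" "\<forall>x\<in>set K'. e \<le> fst x" "good K'"
        using gK K K' by (auto simp: good_Cons)
      have bN: "b / N' \<le> B / N"
      proof -
        have "b / N' \<le> b / 1" using b N' by (intro divide_left_mono) auto
        with b show ?thesis by simp
      qed
      consider "e = zero_elt" | "e \<noteq> zero_elt" "e < r" | "e \<noteq> zero_elt" "r \<le> e" by force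
      then show ?thesis
      proof cases
        case 1
        then show ?thesis using K K' b by (auto split: if_splits)
      next
        case 2
        then have "fund N' e < r" using fund_less[OF pos_if_not_zero_elt, of e N'] by auto
        then show ?thesis using 2 K K' b bN N' by auto
      next
        case 3
        then have "low r K' = 0"
          using b by (auto intro!: low_eq_0)
        moreover have "r \<le> fund N' e" if "r \<noteq> e" using that cof N' b 3 by auto
        ultimately show ?thesis using 3 K K' b bN N' B by (cases "r = e") auto
      qed
    qed (use K in auto)
  qed
qed auto

text \<open>
  Compare an affordable set \<open>J\<close> of blocks of \<open>K @ s\<close> with \<open>(d, B) # s\<close>.  If the clock also affords the
  unbroken block next to the part of \<open>J\<close> in \<open>s\<close>, then replacing the pieces by this block loses nothing.
  Otherwise the time left for the pieces has only exponents below \<open>d\<close>.  With \<open>r\<close> the largest of them,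
  at most \<open>size C\<close> pieces of exponent at least \<open>r\<close> can be paid, and by \<open>low_fragments\<close> these and all
  the smaller pieces together are worth at most \<open>(size C + 1) * (B / N)\<close>.
\<close>
lemma gain_fragments:
  assumes "reach N [(d, B)] K" "1 \<le> N" "good ((d, B) # s)"
    and cof: "\<And>N' d e. N \<le> N' \<Longrightarrow> e \<in># C \<Longrightarrow> e < d \<Longrightarrow> d \<le> bound \<Longrightarrow> e \<le> fund N' d"
  shows "gain (K @ s) C \<le> gain ((d, B) # s) C + (size C + 1) * (B / N)"
proof (rule gain_leI)
  fix J assume J: "J \<subseteq># mset (K @ s)" "image_mset fst J \<le> C"
  \<comment> \<open>The chosen pieces of the broken block and the chosen untouched blocks.\<close>
  define J1 where "J1 = J \<inter># mset K"
  define J2 where "J2 = J - J1"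
  have J12: "J = J1 + J2" "J1 \<subseteq># mset K" "J2 \<subseteq># mset s"
    using J(1) by (auto simp: J1_def J2_def multiset_eq_iff subseteq_mset_def) (metis add.commute le_diff_conv)
  have good: "0 \<le> B" "d \<le> bound" "\<forall>x\<in>set s. d \<le> fst x" "good s" "good [(d, B)]"
    using assms(3) by (auto simp: good_Cons) (auto simp: good_def)
  have gK: "good K" using assms(1) good(5) by (rule reach_good)
  have BN: "0 \<le> B / N" using good by auto
  then have BN': "0 \<le> (size C + 1) * (B / N)" by (intro mult_nonneg_nonneg) auto
  have J1_le: "budget J1 \<le> B"
    using budget_mono[OF J12(2)] reach_budget[OF assms(1,2) good(5)] gK by (auto simp: good_def)
  have J2_le: "budget J2 \<le> gain ((d, B) # s) C"
  proof (rule gain_geI)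
    show "J2 \<subseteq># mset ((d, B) # s)" using J12(3) by (auto intro: subset_mset.order_trans)
    have "image_mset fst J2 \<le> image_mset fst J" by (intro subset_eq_imp_le_multiset) (auto simp: J12)
    then show "image_mset fst J2 \<le> C" using J(2) by (rule order_trans)
  qed
  show "budget J \<le> gain ((d, B) # s) C + (size C + 1) * (B / N)"
  proof (cases "add_mset d (image_mset fst J2) \<le> C")
    case True
    have "budget (add_mset (d, B) J2) \<le> gain ((d, B) # s) C"
      using True J12(3) by (intro gain_geI) auto
    then have "budget J \<le> gain ((d, B) # s) C" using J1_le by (auto simp: J12)
    then show ?thesis using BN' by linarith
  next
    case False
    let ?A = "image_mset fst J2"
    have "\<And>a. a \<in># ?A \<Longrightarrow> d \<le> a" using J12(3) good(3) by (auto dest!: mset_subset_eqD)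
    moreover have "?A + image_mset fst J1 \<le> C" using J(2) by (simp add: J12 add.commute)
    ultimately have "filter_mset (\<lambda>c. d \<le> c) C = ?A"
      using False by (intro mset_filter_if_squeezed[of _ "image_mset fst J1"]) auto
    define R where "R = filter_mset (\<lambda>c. \<not> d \<le> c) C"
    have CR: "C = ?A + R"
      using multiset_partition[of C "\<lambda>c. d \<le> c"] \<open>filter_mset _ C = ?A\<close> by (simp add: R_def)
    have J1R: "image_mset fst J1 \<le> R"
      using \<open>?A + image_mset fst J1 \<le> C\<close> by (subst (asm) CR) simp
    have "budget J1 \<le> (size C + 1) * (B / N)"
    proof (cases "R = {#}")
      case True
      then have "J1 = {#}" using J1R by (metis image_mset_is_empty_iff less_eq_multiset_empty_right)
      then show ?thesis using BN' by simp
    next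
      case False
      define r where "r = Max (set_mset R)"
      have r: "r \<in># R" "\<And>x. x \<in># R \<Longrightarrow> x \<le> r" using False by (auto simp: r_def)
      have rd: "r < d" and rC: "r \<in># C" using r(1) by (auto simp: R_def)
      \<comment> \<open>The unbroken block itself is too expensive for the remaining time \<open>R\<close>.\<close>
      have "K \<noteq> [(d, B)] \<or> J1 = {#}"
      proof (rule ccontr)
        assume "\<not> ?thesis"
        then have "J1 = {#(d, B)#}" using J12(2) by (cases J1) auto
        then have "\<not> R < {#d#}" using J1R by (auto simp: not_less simp del: mset_lt_single_right_iff)
        then show False by (auto simp: R_def)
      qed
      then show ?thesis
      proof
        assume "K \<noteq> [(d, B)]"
        then have K: "\<forall>x\<in>set K. snd x \<le> B / N" "low r K \<le> B / N"
          using low_fragments[OF assms(1,2) rd good(5)] cof[OF _ rC] by auto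
        let ?H = "filter_mset (\<lambda>x. r \<le> fst x) J1" and ?L = "filter_mset (\<lambda>x. fst x < r) J1"
        have "J1 = ?H + ?L"
          using multiset_partition[of J1 "\<lambda>x. r \<le> fst x"] by (simp add: not_le)
        then have "budget J1 = budget ?H + budget ?L" by (metis budget_simps(3))
        moreover have "budget ?L \<le> B / N"
        proof -
          have "budget ?L \<le> low r K"
            unfolding low_def using gK J12(2)
            by (intro budget_mono multiset_filter_mono) (auto simp: good_def)
          with K show ?thesis by auto
        qed
        moreover have "budget ?H \<le> size ?H * (B / N)"
        proof -
          have "budget ?H \<le> (\<Sum>x\<in>#?H. B / N)"
            unfolding budget_def using K J12(2) by (intro sum_mset_mono) (auto dest!: mset_subset_eqD)
          then show ?thesis by simp
        qed
        moreover have "size ?H * (B / N) \<le> size C * (B / N)"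
        proof -
          have "size ?H = size (filter_mset (\<lambda>x. r \<le> x) (image_mset fst J1))"
            by (simp add: filter_mset_image_mset)
          also have "\<dots> \<le> size R" using J1R r(2) by (rule size_le_if_mset_le)
          also have "\<dots> \<le> size C" by (subst CR) simp
          finally show ?thesis using BN by (intro mult_right_mono) auto
        qed
        ultimately show ?thesis by (simp add: algebra_simps)
      qed (use BN' in simp)
    qed
    then show ?thesis using J2_le by (auto simp: J12)
  qed
qed

text \<open>
  By induction on the stack: either the first block is still being played, and \<open>gain_fragments\<close> applies
  once \<open>N\<close> exceeds the indices that belong to the finitely many exponents of \<open>C\<close>, or it is gone
  and the position is reachable from the rest.
\<close>
lemma gain_upper_semicontinuous:
  assumes "good s" "0 < \<epsilon>"
  shows "\<exists>N0. \<forall>N\<ge>N0. \<forall>t. reach N s t \<longrightarrow> gain t C \<le> gain s C + \<epsilon>"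
  using assms(1)
proof (induction s)
  case Nil
  have "t = []" if "reach N [] t" for N t
    using that by (induction rule: reach.induct) auto
  then show ?case using assms(2) by (intro exI[of _ 0]) (fastforce intro: add_increasing2)
next
  case (Cons x s)
  obtain d B where x: "x = (d, B)" by fastforce
  have good: "good s" "good ((d, B) # s)" "0 \<le> B" using Cons.prems by (auto simp: x good_Cons)
  obtain N1 where N1: "\<And>N t. N1 \<le> N \<Longrightarrow> reach N s t \<Longrightarrow> gain t C \<le> gain s C + \<epsilon>"
    using Cons.IH[OF good(1)] by auto
  have "\<forall>e\<in>{e \<in> set_mset C. e < bound}. \<exists>N0. \<forall>N\<ge>N0. \<forall>d. e < d \<and> d \<le> bound \<longrightarrow> e \<le> fund N d"
    using fund_cofinal by auto
  from this[unfolded bchoice_iff] obtain N2 where N2: "\<And>e N d. e \<in># C \<Longrightarrow> e < bound \<Longrightarrow> N2 e \<le> N \<Longrightarrow> e < d \<Longrightarrow> d \<le> bound \<Longrightarrow> e \<le> fund N d"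
    by blast
  define N3 where "N3 = Max (insert 0 (N2 ` set_mset C))"
  have N3: "N2 e \<le> N3" if "e \<in># C" for e
    using that by (auto simp: N3_def)
  obtain N4 :: nat where N4: "(size C + 1) * B / \<epsilon> \<le> N4" using real_arch_simple by blast
  show ?case
  proof (intro exI[of _ "Max {N1, N3, N4, 1}"] allI impI)
    fix N t assume N: "Max {N1, N3, N4, 1} \<le> N" and t: "reach N (x # s) t"
    then have N': "N1 \<le> N" "N3 \<le> N" "N4 \<le> N" "1 \<le> N" by auto
    have "reach N ([(d, B)] @ s) t" using t x by simp
    then have "gain t C \<le> gain ((d, B) # s) C + \<epsilon>"
    proof (rule reach_append[THEN disjE], elim exE conjE)
      fix K assume K: "reach N [(d, B)] K" "t = K @ s"
      have "gain t C \<le> gain ((d, B) # s) C + (size C + 1) * (B / N)"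
        unfolding K(2) using N3 N' by (intro gain_fragments[OF K(1) _ good(2)] N2) (auto intro: order_trans less_le_trans)
      moreover have "(size C + 1) * (B / N) \<le> \<epsilon>"
      proof -
        have "(size C + 1) * B / \<epsilon> \<le> N" using N4 N' by linarith
        then show ?thesis using assms(2) N' by (simp add: field_simps)
      qed
      ultimately show ?thesis by linarith
    next
      assume "reach N s t"
      then have "gain t C \<le> gain s C + \<epsilon>" using N1 N' by auto
      also have "gain s C \<le> gain ((d, B) # s) C"
        by (intro gain_leI gain_geI) (auto intro: subset_mset.order_trans)
      finally show ?thesis by simp
    qed
    then show "gain t C \<le> gain (x # s) C + \<epsilon>" by (simp add: x)
  qed
qed

end

text \<open>
  Nodes occur as indices of coordinates through their codes, which must not be evaluated.
\<close>
declare list_encode.simps [simp del]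

section \<open>The simplex of probability measures on a well-founded tree\<close>

text \<open>
  A node is the list of the branch numbers on the path to it, the last one first, so that the children of
  \<open>s\<close> are the lists \<open>n # s\<close> and the descendants of \<open>s\<close> are the lists with suffix \<open>s\<close>.
\<close>
definition subtree :: "nat list \<Rightarrow> nat list set" where
  "subtree s = {t. suffix s t}"

abbreviation coord :: "(nat \<Rightarrow> real) \<Rightarrow> nat list \<Rightarrow> real" where
  "coord x s \<equiv> x (list_encode s)"

text \<open>
  A measure is represented by the masses of all subtrees.  In these coordinates the weak topology is the
  product topology, since the subtrees are a subbase of clopen sets together with their complements.
\<close>
definition point :: "nat list pmf \<Rightarrow> nat \<Rightarrow> real" where
  "point p i = measure_pmf.prob p (subtree (list_decode i))"

lemma coord_point: "coord (point p) s = measure_pmf.prob p (subtree s)"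
  by (simp add: point_def)

lemma subtree_Nil [simp]: "subtree [] = UNIV"
  by (simp add: subtree_def)

lemma in_subtree_self [simp]: "s \<in> subtree s"
  by (simp add: subtree_def)

lemma subtree_split: "subtree s = insert s (\<Union>n. subtree (n # s))"
proof -
  have "t = [] \<or> (\<exists>n zs. t = zs @ [n])" for t :: "nat list"
    by (cases t rule: rev_cases) auto
  then show ?thesis
    by (auto simp: subtree_def suffix_def) (metis append.assoc append_Cons append_Nil)+
qed

lemma not_in_subtree_Cons [simp]: "s \<notin> subtree (n # s)"
  by (auto simp: subtree_def suffix_def)

lemma disjoint_subtrees: "disjoint_family (\<lambda>n. subtree (n # s))"
proof -
  have "m = n" if "a @ m # s = b @ n # s" for a b m n
  proof -
    have "(a @ [m]) @ s = (b @ [n]) @ s" using that by simp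
    then show ?thesis unfolding append_same_eq by simp
  qed
  then show ?thesis
    by (fastforce simp: disjoint_family_on_def subtree_def suffix_def)
qed

lemma subtree_Cons_subset: "subtree (n # s) \<subseteq> subtree s"
  using subtree_split[of s] by blast

lemma emeasure_subtree_split:
  assumes "sets \<mu> = UNIV"
  shows "emeasure \<mu> (subtree s) = emeasure \<mu> {s} + (\<Sum>n. emeasure \<mu> (subtree (n # s)))"
proof -
  have "emeasure \<mu> (subtree s) = emeasure \<mu> ({s} \<union> (\<Union>n. subtree (n # s)))"
    by (subst subtree_split) simp
  also have "\<dots> = emeasure \<mu> {s} + emeasure \<mu> (\<Union>n. subtree (n # s))"
    using assms by (intro plus_emeasure[symmetric]) auto
  also have "emeasure \<mu> (\<Union>n. subtree (n # s)) = (\<Sum>n. emeasure \<mu> (subtree (n # s)))"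
    using assms disjoint_subtrees by (intro suminf_emeasure[symmetric]) auto
  finally show ?thesis .
qed

lemma sums_subtrees:
  "(\<lambda>n. measure_pmf.prob p (subtree (n # s))) sums (measure_pmf.prob p (subtree s) - pmf p s)"
proof -
  have "(\<lambda>n. measure_pmf.prob p (subtree (n # s))) sums measure_pmf.prob p (\<Union>n. subtree (n # s))"
    by (intro measure_pmf.finite_measure_UNION disjoint_subtrees) auto
  also have "measure_pmf.prob p (\<Union>n. subtree (n # s)) = measure_pmf.prob p (subtree s - {s})"
    by (intro arg_cong[where f = "measure_pmf.prob p"]) (subst (2) subtree_split, auto)
  also have "\<dots> = measure_pmf.prob p (subtree s) - pmf p s"
    by (subst measure_pmf.finite_measure_Diff) (auto simp: measure_pmf_single)
  finally show ?thesis .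
qed

text \<open>
  The mass of the node itself, recovered from the masses of the subtrees.
\<close>
definition mass :: "(nat \<Rightarrow> real) \<Rightarrow> nat list \<Rightarrow> real" where
  "mass x s = coord x s - (\<Sum>n. coord x (n # s))"

lemma mass_point [simp]: "mass (point p) s = pmf p s"
  using sums_subtrees[of p s] by (simp add: mass_def coord_point sums_iff)

lemma point_eq_iff [simp]: "point p = point q \<longleftrightarrow> p = q"
  by (metis mass_point pmf_eqI)

lemma nn_integral_pmf_suminf:
  "(\<integral>\<^sup>+s. f s \<partial>measure_pmf p) = (\<Sum>i. f (list_decode i) * ennreal (pmf p (list_decode i)))"
proof -
  have "(\<integral>\<^sup>+s. f s \<partial>measure_pmf p) = (\<integral>\<^sup>+s. f s * ennreal (pmf p s) \<partial>count_space UNIV)"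
    by (simp add: nn_integral_measure_pmf mult.commute)
  also have "\<dots> = (\<integral>\<^sup>+i. f (list_decode i) * ennreal (pmf p (list_decode i)) \<partial>count_space UNIV)"
    by (rule nn_integral_bij_count_space[OF bij_list_decode, symmetric])
  finally show ?thesis by (simp add: nn_integral_count_space_nat)
qed

lemma suminf_le_if_sums_le:
  fixes f :: "nat \<Rightarrow> ennreal"
  assumes "\<And>N. (\<Sum>i<N. f i) \<le> c"
  shows "suminf f \<le> c"
  unfolding suminf_eq_SUP using assms by (rule SUP_least)

lemma sum_le_nn_integral_pmf:
  "(\<Sum>i<N. f (list_decode i) * ennreal (pmf p (list_decode i))) \<le> (\<integral>\<^sup>+s. f s \<partial>measure_pmf p)"
  unfolding nn_integral_pmf_suminf by (rule sum_le_suminf) auto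

lemma less_list_encode: "n \<in> set s \<Longrightarrow> n < list_encode s"
proof (induction s)
  case (Cons m s)
  have "m \<le> prod_encode (m, list_encode s)" "list_encode s \<le> prod_encode (m, list_encode s)"
    by (rule le_prod_encode_1, rule le_prod_encode_2)
  then show ?case using Cons by (auto simp: list_encode.simps)
qed simp

lemma opens_subset_Pow: "{U. openin T U} \<subseteq> Pow (topspace T)"
  by (auto dest: openin_subset)

lemma sum_apply: "(\<Sum>i\<in>A. f i) x = (\<Sum>i\<in>A. f i x)" for f :: "'i \<Rightarrow> 'a \<Rightarrow> real"
  by (induction A rule: infinite_finite_induct) (auto simp: zero_fun_def plus_fun_def)

lemma tendsto_fun:
  fixes f :: "nat \<Rightarrow> 'a \<Rightarrow> real"
  assumes "\<And>i. (\<lambda>k. f k i) \<longlonglongrightarrow> l i"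
  shows "f \<longlonglongrightarrow> l"
proof -
  have "limitin (product_topology (\<lambda>_. euclideanreal) UNIV) f l sequentially"
    using assms by (simp add: limitin_componentwise)
  then show ?thesis by (simp add: euclidean_product_topology)
qed

lemma hausdorff_locally_convex_product:
  "hausdorff_locally_convex (euclidean :: (nat \<Rightarrow> real) topology)"
  unfolding hausdorff_locally_convex_def
proof (intro conjI allI impI)
  have "continuous_on UNIV (\<lambda>z :: (nat \<Rightarrow> real) \<times> (nat \<Rightarrow> real). \<lambda>i. fst z i + snd z i)"
    by (intro continuous_on_coordinatewise_then_product continuous_intros
        continuous_on_product_then_coordinatewise[OF continuous_on_fst]
        continuous_on_product_then_coordinatewise[OF continuous_on_snd])
  then show "continuous_map (prod_topology euclidean euclidean) euclidean (\<lambda>(x :: nat \<Rightarrow> real, y). x + y)"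
    by (simp add: case_prod_unfold plus_fun_def)
  have "continuous_on UNIV (\<lambda>z :: real \<times> (nat \<Rightarrow> real). \<lambda>i. fst z * snd z i)"
    by (intro continuous_on_coordinatewise_then_product continuous_intros
        continuous_on_product_then_coordinatewise[OF continuous_on_snd])
  then show "continuous_map (prod_topology euclideanreal euclidean) euclidean (\<lambda>(c, x :: nat \<Rightarrow> real). c *\<^sub>R x)"
    by (simp add: case_prod_unfold scaleR_fun_def)
next
  fix U :: "(nat \<Rightarrow> real) set" assume U: "openin euclidean U \<and> 0 \<in> U"
  then have "\<exists>Y. 0 \<in> PiE UNIV Y \<and> (\<forall>i. openin euclideanreal (Y i)) \<and>
      finite {i. Y i \<noteq> topspace euclideanreal} \<and> PiE UNIV Y \<subseteq> U"
    by (intro product_topology_open_contains_basis) (auto simp: euclidean_product_topology)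
  then obtain Y :: "nat \<Rightarrow> real set" where Y: "0 \<in> PiE UNIV Y" "\<And>i. open (Y i)" "finite {i. Y i \<noteq> UNIV}" "PiE UNIV Y \<subseteq> U"
    by auto
  have "\<exists>e>0. ball 0 e \<subseteq> Y i" for i
    using Y(1) Y(2)[of i] by (auto simp: open_contains_ball PiE_def Pi_def zero_fun_def)
  then obtain e where e: "\<And>i. e i > 0" "\<And>i. ball 0 (e i) \<subseteq> Y i" by metis
  define Z :: "nat \<Rightarrow> real set" where "Z i = (if Y i = UNIV then UNIV else ball 0 (e i))" for i
  have "{i. Z i \<noteq> UNIV} \<subseteq> {i. Y i \<noteq> UNIV}" by (auto simp: Z_def)
  then have "open (PiE UNIV Z)"
    using Y(3) finite_subset by (intro open_PiE) (auto simp: Z_def)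
  moreover have "convex (Z i)" for i by (auto simp: Z_def)
  then have "convex (PiE UNIV Z)"
    unfolding convex_def by (simp add: PiE_def Pi_def scaleR_fun_def)
  moreover have "PiE UNIV Z \<subseteq> PiE UNIV Y" using e by (intro PiE_mono) (auto simp: Z_def)
  moreover have "0 \<in> PiE UNIV Z" using e by (auto simp: Z_def zero_fun_def)
  ultimately show "\<exists>V. openin euclidean V \<and> 0 \<in> V \<and> convex V \<and> V \<subseteq> U"
    using Y(4) by (metis open_openin order_trans)
qed auto


text \<open>
  Well-foundedness, that is, the absence of infinite branches, makes the space of nodes compact: without
  it, mass could escape along a branch.
\<close>
locale wf_tree =
  fixes Tr :: "nat list set"
  assumes root: "[] \<in> Tr"
    and parent: "n # s \<in> Tr \<Longrightarrow> s \<in> Tr"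
    and wf: "wf {(n # s, s) |n s. n # s \<in> Tr}"
begin

text \<open>
  Since the children of a node may be infinitely many, the additivity of a measure survives in the limit
  only as an inequality; the missing mass sits on the node itself.
\<close>
definition tree_simplex :: "(nat \<Rightarrow> real) set" where
  "tree_simplex = {x. coord x [] = 1 \<and> (\<forall>s. s \<notin> Tr \<longrightarrow> coord x s = 0) \<and> (\<forall>s. 0 \<le> coord x s) \<and>
     (\<forall>s N. (\<Sum>n<N. coord x (n # s)) \<le> coord x s)}"

lemma subtree_Tr: "t \<in> subtree s \<Longrightarrow> t \<in> Tr \<Longrightarrow> s \<in> Tr"
proof (induction t)
  case (Cons n t)
  then show ?case
    by (cases "s = n # t") (auto simp: subtree_def suffix_Cons dest: parent)
qed (auto simp: subtree_def)

lemma tree_induct [consumes 1, case_names node]: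
  assumes "s \<in> Tr" "\<And>s. s \<in> Tr \<Longrightarrow> (\<And>n. n # s \<in> Tr \<Longrightarrow> P (n # s)) \<Longrightarrow> P s"
  shows "P s"
  using wf assms(1)
proof (induction s rule: wf_induct_rule)
  case (less s)
  then show ?case using assms(2) by blast
qed

lemma point_in_simplex:
  assumes "set_pmf p \<subseteq> Tr"
  shows "point p \<in> tree_simplex"
proof -
  have "measure_pmf.prob p (subtree s) = 0" if "s \<notin> Tr" for s
    using that assms subtree_Tr[of _ s] by (auto simp: measure_pmf_zero_iff)
  moreover have "(\<Sum>n<N. measure_pmf.prob p (subtree (n # s))) \<le> measure_pmf.prob p (subtree s)" for s N
  proof -
    have "(\<Sum>n<N. measure_pmf.prob p (subtree (n # s))) = measure_pmf.prob p (\<Union>n<N. subtree (n # s))"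
      using disjoint_subtrees[of s]
      by (intro measure_pmf.finite_measure_finite_Union[symmetric]) (auto simp: disjoint_family_on_def)
    also have "\<dots> \<le> measure_pmf.prob p (subtree s)"
      using subtree_Cons_subset by (intro measure_pmf.finite_measure_mono) auto
    finally show ?thesis .
  qed
  ultimately show ?thesis
    by (auto simp: tree_simplex_def coord_point)
qed

lemma mass_nonneg_and_sums:
  assumes "x \<in> tree_simplex"
  shows "0 \<le> mass x s" "(\<lambda>n. coord x (n # s)) sums (coord x s - mass x s)"
proof -
  have x: "\<And>s. 0 \<le> coord x s" "\<And>s N. (\<Sum>n<N. coord x (n # s)) \<le> coord x s"
    using assms by (auto simp: tree_simplex_def)
  have "summable (\<lambda>n. coord x (n # s))"
    using x by (intro summableI_nonneg_bounded) auto
  then show "(\<lambda>n. coord x (n # s)) sums (coord x s - mass x s)"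
    by (simp add: mass_def sums_iff)
  show "0 \<le> mass x s"
    using x suminf_le_const[OF \<open>summable _\<close>] by (simp add: mass_def)
qed

text \<open>
  The masses of the nodes define a measure.  That it gives each subtree the prescribed mass follows by
  induction from the leaves towards the root, which is where well-foundedness enters.
\<close>
lemma simplex_pointE:
  assumes "x \<in> tree_simplex"
  obtains p where "set_pmf p \<subseteq> Tr" "x = point p"
proof -
  define \<mu> where "\<mu> = density (count_space UNIV) (\<lambda>s. ennreal (mass x s))"
  have sets: "sets \<mu> = UNIV" by (simp add: \<mu>_def)
  have x: "\<And>s. 0 \<le> coord x s" "\<And>s. s \<notin> Tr \<Longrightarrow> coord x s = 0" "coord x [] = 1"
    using assms by (auto simp: tree_simplex_def)
  have single: "emeasure \<mu> {s} = mass x s" for s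
    by (simp add: \<mu>_def emeasure_density nn_integral_count_space_indicator[symmetric]
        nn_integral_count_space_finite)
  have off: "mass x s = 0" if "s \<notin> Tr" for s
  proof -
    have "coord x s = 0" "\<And>n. coord x (n # s) = 0" using that x(2) parent by blast+
    then show ?thesis by (simp add: mass_def)
  qed
  have off_subtree: "emeasure \<mu> (subtree s) = 0" if "s \<notin> Tr" for s
  proof -
    have "ennreal (mass x t) * indicator (subtree s) t = 0" for t
      using that off[of t] subtree_Tr[of t s] by (cases "t \<in> Tr") (auto simp: indicator_def)
    then have "(\<integral>\<^sup>+t. ennreal (mass x t) * indicator (subtree s) t \<partial>count_space UNIV) = 0"
      by (simp only: nn_integral_const mult_zero_left)
    then show ?thesis by (simp add: \<mu>_def emeasure_density)
  qed
  have sub: "emeasure \<mu> (subtree s) = coord x s" for s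
  proof (cases "s \<in> Tr")
    case True
    then show ?thesis
    proof (induction rule: tree_induct)
      case (node s)
      have "emeasure \<mu> (subtree (n # s)) = coord x (n # s)" for n
      proof (cases "n # s \<in> Tr")
        case False
        then show ?thesis using off_subtree x by simp
      qed (use node in auto)
      then have "emeasure \<mu> (subtree s) = mass x s + (\<Sum>n. ennreal (coord x (n # s)))"
        by (simp only: emeasure_subtree_split[OF sets, of s] single)
      also have "(\<Sum>n. ennreal (coord x (n # s))) = ennreal (coord x s - mass x s)"
        using mass_nonneg_and_sums[OF assms, of s] x by (intro suminf_ennreal_eq) auto
      also have "ennreal (mass x s) + \<dots> = coord x s"
        using mass_nonneg_and_sums[OF assms, of s] x sums_le[OF _ sums_zero mass_nonneg_and_sums(2)[OF assms, of s]]
        by (subst ennreal_plus[symmetric]) auto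
      finally show ?case .
    qed
  next
    case False
    then show ?thesis using off_subtree x by simp
  qed
  define p where "p = embed_pmf (mass x)"
  have total: "(\<integral>\<^sup>+s. ennreal (mass x s) \<partial>count_space UNIV) = 1"
    using sub[of "[]"] x by (simp add: \<mu>_def emeasure_density)
  have pmf: "pmf p s = mass x s" for s
    unfolding p_def using mass_nonneg_and_sums[OF assms] total by (intro pmf_embed_pmf) auto
  have "measure_pmf p = \<mu>"
    by (subst measure_pmf_eq_density) (simp add: \<mu>_def pmf)
  then have "emeasure (measure_pmf p) (subtree s) = coord x s" for s
    by (simp add: sub)
  then have "coord (point p) s = coord x s" for s
    using x by (simp add: coord_point measure_pmf.emeasure_eq_measure)
  then have "point p = x"
    by (intro ext) (metis list_decode_inverse)
  moreover have "set_pmf p \<subseteq> Tr"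
    using off by (auto simp: set_pmf_eq pmf)
  ultimately show ?thesis using that by blast
qed

definition law :: "(nat \<Rightarrow> real) \<Rightarrow> nat list pmf" where
  "law x = (THE p. point p = x)"

lemma law_point [simp]: "law (point p) = p"
  by (auto simp: law_def)

lemma simplex_law: "x \<in> tree_simplex \<Longrightarrow> set_pmf (law x) \<subseteq> Tr" "x \<in> tree_simplex \<Longrightarrow> point (law x) = x"
  by (auto elim!: simplex_pointE)

lemma pmf_law: "x \<in> tree_simplex \<Longrightarrow> pmf (law x) s = mass x s"
  by (metis mass_point simplex_law(2))

lemma prob_law: "x \<in> tree_simplex \<Longrightarrow> measure_pmf.prob (law x) (subtree s) = coord x s"
  by (metis coord_point simplex_law(2))

lemma coord_bounds:
  assumes "x \<in> tree_simplex" shows "0 \<le> coord x s" "coord x s \<le> 1"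
  using prob_law[OF assms, of s] by (metis measure_nonneg, metis measure_pmf.prob_le_1)

lemma closed_simplex: "closed tree_simplex"
proof -
  have "tree_simplex = {x. coord x [] = 1} \<inter> (\<Inter>s\<in>-Tr. {x. coord x s = 0}) \<inter> (\<Inter>s. {x. 0 \<le> coord x s}) \<inter>
     (\<Inter>s. \<Inter>N. {x. (\<Sum>n<N. coord x (n # s)) \<le> coord x s})"
    by (auto simp: tree_simplex_def)
  also have "closed \<dots>"
    by (intro closed_Int closed_INT ballI closed_Collect_eq closed_Collect_le continuous_intros
        continuous_on_product_coordinates)
  finally show ?thesis .
qed

lemma compact_simplex: "compact tree_simplex"
proof -
  have "compactin (product_topology (\<lambda>_::nat. euclideanreal) UNIV) (PiE UNIV (\<lambda>_. {0..1}))"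
    by (subst compactin_PiE) auto
  then have "compact (PiE (UNIV :: nat set) (\<lambda>_. {0..1::real}))"
    by (simp add: euclidean_product_topology)
  moreover have "tree_simplex \<subseteq> PiE UNIV (\<lambda>_. {0..1})"
  proof
    fix x assume "x \<in> tree_simplex"
    then have "0 \<le> x i \<and> x i \<le> 1" for i
      using coord_bounds[of x "list_decode i"] by simp
    then show "x \<in> PiE UNIV (\<lambda>_. {0..1})" by auto
  qed
  ultimately show ?thesis
    using closed_simplex by (metis compact_Int_closed inf.absorb_iff2)
qed

lemma convex_simplex: "convex tree_simplex"
  unfolding convex_def
proof (intro ballI allI impI)
  fix x y and u v :: real assume *: "x \<in> tree_simplex" "y \<in> tree_simplex" "0 \<le> u" "0 \<le> v" "u + v = 1"
  have "(\<Sum>n<N. u * coord x (n # s) + v * coord y (n # s)) \<le> u * coord x s + v * coord y s" for s N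
    using * by (auto simp: sum.distrib sum_distrib_left[symmetric] tree_simplex_def intro!: add_mono mult_left_mono)
  then show "u *\<^sub>R x + v *\<^sub>R y \<in> tree_simplex"
    using * by (auto simp: tree_simplex_def scaleR_fun_def)
qed

text \<open>
  The harmonic extension of a function on the nodes, which are the extreme points.
\<close>
definition har :: "(nat list \<Rightarrow> real) \<Rightarrow> (nat \<Rightarrow> real) \<Rightarrow> ennreal" where
  "har \<Phi> x = (\<integral>\<^sup>+s. ennreal (\<Phi> s) \<partial>measure_pmf (law x))"

abbreviation X :: "(nat \<Rightarrow> real) topology" where
  "X \<equiv> subtopology euclidean tree_simplex"

lemma space_borel_of_X [simp]: "space (borel_of X) = tree_simplex"
  using opens_subset_Pow[of X] by (simp add: borel_of_def)

lemma sets_borel_of_X: "sets (borel_of X) = sigma_sets tree_simplex {U. openin X U}"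
  using opens_subset_Pow[of X] by (simp add: borel_of_def)

lemma continuous_borel_of:
  assumes "continuous_map X euclideanreal g"
  shows "g \<in> borel_measurable (borel_of X)"
proof (rule borel_measurableI)
  fix S :: "real set" assume "open S"
  then have "openin X {x \<in> topspace X. g x \<in> S}"
    using assms openin_continuous_map_preimage open_openin by blast
  moreover have "g -` S \<inter> space (borel_of X) = {x \<in> topspace X. g x \<in> S}"
    by auto
  ultimately show "g -` S \<inter> space (borel_of X) \<in> sets (borel_of X)"
    by (simp only: sets_borel_of_X) (auto intro: sigma_sets.Basic)
qed

lemma coord_continuous: "continuous_map X euclideanreal (\<lambda>x. x i)"
  by (simp add: continuous_on_subset[OF continuous_on_product_coordinates])

lemma coord_measurable [measurable]: "(\<lambda>x. x i) \<in> borel_measurable (borel_of X)"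
  by (rule continuous_borel_of[OF coord_continuous])

lemma mass_measurable [measurable]: "(\<lambda>x. mass x s) \<in> borel_measurable (borel_of X)"
  unfolding mass_def by measurable

lemma borel_prob_measurable:
  "borel_prob X \<mu> \<Longrightarrow> f \<in> borel_measurable (borel_of X) \<Longrightarrow> f \<in> borel_measurable \<mu>"
  by (simp add: borel_prob_def cong: measurable_cong_sets)

lemma borel_prob_space: "borel_prob X \<mu> \<Longrightarrow> space \<mu> = tree_simplex"
  using sets_eq_imp_space_eq[of \<mu> "borel_of X"] by (simp add: borel_prob_def)

lemma nn_integral_coord:
  assumes "borel_prob X \<mu>" "is_barycenter X \<mu> x"
  shows "(\<integral>\<^sup>+y. ennreal (coord y s) \<partial>\<mu>) = ennreal (coord x s)"
proof -
  interpret prob_space \<mu> using assms by (simp add: borel_prob_def)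
  have "affine_map_on tree_simplex (\<lambda>y. coord y s)"
    by (simp add: affine_map_on_def scaleR_fun_def)
  then have "coord x s = (\<integral>y. coord y s \<partial>\<mu>)"
    using assms(2) coord_continuous[of "list_encode s"] unfolding is_barycenter_def by fastforce
  moreover have ae: "AE y in \<mu>. 0 \<le> coord y s" "AE y in \<mu>. norm (coord y s) \<le> 1"
    using coord_bounds[of _ s] borel_prob_space[OF assms(1)] by (auto intro!: AE_I2)
  moreover have "(\<lambda>y. coord y s) \<in> borel_measurable \<mu>"
    using assms(1) coord_measurable by (rule borel_prob_measurable)
  then have "integrable \<mu> (\<lambda>y. coord y s)"
    using ae by (intro integrable_const_bound[of _ 1])
  ultimately show ?thesis
    by (simp only: nn_integral_eq_integral)
qed

lemma coord_eq_suminf: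
  assumes "x \<in> tree_simplex"
  shows "ennreal (coord x s) = ennreal (mass x s) + (\<Sum>n. ennreal (coord x (n # s)))"
proof -
  note * = mass_nonneg_and_sums[OF assms, of s]
  have c: "0 \<le> coord x t" for t using coord_bounds(1)[OF assms] .
  have le: "0 \<le> coord x s - mass x s" using sums_le[OF _ sums_zero *(2)] c by auto
  have "(\<Sum>n. ennreal (coord x (n # s))) = ennreal (coord x s - mass x s)"
    using c by (intro suminf_ennreal_eq *(2)) auto
  then show ?thesis using * le by (simp flip: ennreal_plus)
qed

text \<open>
  The mass of a node is a countable combination of coordinates, and coordinates are continuous and affine.
\<close>
lemma nn_integral_mass:
  assumes "borel_prob X \<mu>" "is_barycenter X \<mu> x"
  shows "(\<integral>\<^sup>+y. ennreal (mass y s) \<partial>\<mu>) = ennreal (mass x s)"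
proof -
  have x: "x \<in> tree_simplex" using assms by (simp add: is_barycenter_def)
  note [measurable] = borel_prob_measurable[OF assms(1) coord_measurable]
    borel_prob_measurable[OF assms(1) mass_measurable]
  have "ennreal (mass x s) + (\<Sum>n. ennreal (coord x (n # s))) = (\<integral>\<^sup>+y. ennreal (coord y s) \<partial>\<mu>)"
    by (simp only: nn_integral_coord[OF assms] coord_eq_suminf[OF x, symmetric])
  also have "\<dots> = (\<integral>\<^sup>+y. ennreal (mass y s) + (\<Sum>n. ennreal (coord y (n # s))) \<partial>\<mu>)"
    by (intro nn_integral_cong coord_eq_suminf) (simp add: borel_prob_space[OF assms(1)])
  also have "\<dots> = (\<integral>\<^sup>+y. ennreal (mass y s) \<partial>\<mu>) + (\<Sum>n. ennreal (coord x (n # s)))"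
    by (simp add: nn_integral_add nn_integral_suminf nn_integral_coord[OF assms])
  finally have "(\<Sum>n. ennreal (coord x (n # s))) + ennreal (mass x s) =
      (\<Sum>n. ennreal (coord x (n # s))) + (\<integral>\<^sup>+y. ennreal (mass y s) \<partial>\<mu>)"
    by (simp add: add.commute)
  moreover have "(\<Sum>n. ennreal (coord x (n # s))) \<noteq> \<top>"
    using coord_eq_suminf[OF x, of s] by (metis ennreal_add_eq_top ennreal_neq_top infinity_ennreal_def)
  ultimately show ?thesis
    by (subst (asm) ennreal_add_left_cancel) auto
qed

lemma har_suminf:
  assumes "x \<in> tree_simplex"
  shows "har \<Phi> x = (\<Sum>i. ennreal (\<Phi> (list_decode i)) * ennreal (mass x (list_decode i)))"
  by (simp add: har_def nn_integral_pmf_suminf pmf_law[OF assms])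

lemma har_measurable: "har \<Phi> \<in> borel_measurable (borel_of X)"
proof -
  have "(\<lambda>x. \<Sum>i. ennreal (\<Phi> (list_decode i)) * ennreal (mass x (list_decode i))) \<in> borel_measurable (borel_of X)"
    by measurable
  then show ?thesis
    by (subst measurable_cong[OF har_suminf]) auto
qed

lemma harmonic_har: "harmonic X (har \<Phi>)"
  unfolding harmonic_def
proof (intro conjI allI impI har_measurable, elim conjE)
  fix \<mu> x assume \<mu>: "borel_prob X \<mu>" "is_barycenter X \<mu> x"
  have x: "x \<in> tree_simplex" using \<mu> by (simp add: is_barycenter_def)
  note [measurable] = borel_prob_measurable[OF \<mu>(1) mass_measurable]
  have "(\<integral>\<^sup>+y. har \<Phi> y \<partial>\<mu>) = (\<integral>\<^sup>+y. (\<Sum>i. ennreal (\<Phi> (list_decode i)) * ennreal (mass y (list_decode i))) \<partial>\<mu>)"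
    by (intro nn_integral_cong har_suminf) (simp add: borel_prob_space[OF \<mu>(1)])
  also have "\<dots> = har \<Phi> x"
    by (simp add: nn_integral_suminf nn_integral_cmult nn_integral_mass[OF \<mu>] har_suminf[OF x])
  finally show "har \<Phi> x = (\<integral>\<^sup>+y. har \<Phi> y \<partial>\<mu>)" by simp
qed

text \<open>
  Lists outside the tree are sent to the root only to make \<open>vertex\<close> a map into the simplex.
\<close>
definition vertex :: "nat list \<Rightarrow> nat \<Rightarrow> real" where
  "vertex s = point (return_pmf (if s \<in> Tr then s else []))"

lemma vertex_in_simplex [simp]: "vertex s \<in> tree_simplex"
  unfolding vertex_def using root by (intro point_in_simplex) auto

lemma coord_vertex: "s \<in> Tr \<Longrightarrow> coord (vertex s) t = indicator (subtree t) s"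
  by (simp add: vertex_def coord_point)

lemma mass_vertex: "s \<in> Tr \<Longrightarrow> mass (vertex s) t = indicator {t} s"
  by (simp add: vertex_def indicator_def pmf_return)

lemma vertex_eq_iff: "s \<in> Tr \<Longrightarrow> t \<in> Tr \<Longrightarrow> vertex s = vertex t \<longleftrightarrow> s = t"
  by (simp add: vertex_def)

lemma vertex_measurable [measurable]: "vertex \<in> measurable (measure_pmf p) (borel_of X)"
  by (auto simp: measurable_def)

lemma affine_point_finite:
  assumes "affine_map_on tree_simplex g" "finite (set_pmf p)" "set_pmf p \<subseteq> Tr"
  shows "g (point p) = (\<integral>s. g (vertex s) \<partial>measure_pmf p)"
proof -
  let ?F = "set_pmf p"
  have pt: "point p = (\<Sum>s\<in>?F. pmf p s *\<^sub>R vertex s)"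
  proof
    fix i
    have "point p i = (\<integral>s. indicator (subtree (list_decode i)) s \<partial>measure_pmf p)"
      by (simp add: point_def)
    also have "\<dots> = (\<Sum>s\<in>?F. pmf p s *\<^sub>R indicator (subtree (list_decode i)) s)"
      using assms(2) by (intro integral_measure_pmf) auto
    also have "\<dots> = (\<Sum>s\<in>?F. pmf p s *\<^sub>R vertex s) i"
      unfolding sum_apply scaleR_fun_def
    proof (rule sum.cong)
      fix s assume "s \<in> ?F"
      then have "vertex s i = indicator (subtree (list_decode i)) s"
        using assms(3) coord_vertex[of s "list_decode i"] by auto
      then show "pmf p s *\<^sub>R indicator (subtree (list_decode i)) s = pmf p s *\<^sub>R vertex s i" by simp
    qed simp
    finally show "point p i = (\<Sum>s\<in>?F. pmf p s *\<^sub>R vertex s) i" .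
  qed
  have "convex_on tree_simplex g" "convex_on tree_simplex (\<lambda>x. - g x)"
    using assms(1) convex_simplex by (auto simp: affine_map_on_def intro!: convex_onI)
  moreover have sum1: "(\<Sum>s\<in>?F. pmf p s) = 1"
    using assms(2) by (intro sum_pmf_eq_1) auto
  ultimately have "g (point p) \<le> (\<Sum>s\<in>?F. pmf p s * g (vertex s))"
      "- g (point p) \<le> (\<Sum>s\<in>?F. pmf p s * - g (vertex s))"
    unfolding pt using assms(2) set_pmf_not_empty[of p]
    by (intro convex_on_sum[of ?F tree_simplex g] convex_on_sum[of ?F tree_simplex "\<lambda>x. - g x"]; simp)+
  then have "g (point p) = (\<Sum>s\<in>?F. pmf p s * g (vertex s))"
    by (simp add: sum_negf)
  also have "\<dots> = (\<integral>s. g (vertex s) \<partial>measure_pmf p)"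
    using assms(2) by (subst integral_measure_pmf[of ?F]) auto
  finally show ?thesis .
qed

lemma bounded_on_simplex:
  assumes "continuous_on tree_simplex g"
  obtains B :: real where "\<And>x. x \<in> tree_simplex \<Longrightarrow> \<bar>g x\<bar> \<le> B"
proof -
  have "bounded (g ` tree_simplex)"
    using assms compact_simplex by (intro compact_imp_bounded compact_continuous_image)
  then show ?thesis using that by (auto simp: bounded_iff)
qed

text \<open>
  A continuous affine function is integrated by the law of a point: this is linearity for laws with finite
  support, and moving all mass outside the first \<open>k\<close> nodes to the root approximates any law by such.
\<close>
lemma affine_point:
  assumes "affine_map_on tree_simplex g" "continuous_on tree_simplex g" "set_pmf p \<subseteq> Tr"
  shows "g (point p) = (\<integral>s. g (vertex s) \<partial>measure_pmf p)"
proof -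
  define cut where "cut k s = (if list_encode s < k then s else [])" for k s
  define P where "P k = map_pmf (cut k) p" for k
  have lim: "(\<lambda>k. \<integral>s. f s \<partial>measure_pmf (P k)) \<longlonglongrightarrow> (\<integral>s. f s \<partial>measure_pmf p)"
    if "\<And>s. \<bar>f s\<bar> \<le> B" for f :: "nat list \<Rightarrow> real" and B
    unfolding P_def integral_map_pmf
  proof (rule integral_dominated_convergence[where w = "\<lambda>_. B"])
    show "AE s in measure_pmf p. (\<lambda>k. f (cut k s)) \<longlonglongrightarrow> f s"
    proof (rule AE_I2)
      fix s
      have "eventually (\<lambda>k. f (cut k s) = f s) sequentially"
        using eventually_gt_at_top[of "list_encode s"] by eventually_elim (simp add: cut_def)
      then show "(\<lambda>k. f (cut k s)) \<longlonglongrightarrow> f s" by (rule tendsto_eventually)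
    qed
  qed (use that in auto)
  have fin: "finite (set_pmf (P k))" for k
  proof (rule finite_subset)
    show "set_pmf (P k) \<subseteq> insert [] (list_decode ` {..<k})"
      by (auto simp: P_def cut_def image_iff) (metis lessThan_iff list_encode_inverse)
  qed auto
  have sub: "set_pmf (P k) \<subseteq> Tr" for k
    using assms(3) root by (auto simp: P_def cut_def)
  have "(\<lambda>k. point (P k)) \<longlonglongrightarrow> point p"
  proof (rule tendsto_fun)
    fix i
    have "(\<lambda>k. \<integral>s. indicator (subtree (list_decode i)) s \<partial>measure_pmf (P k)) \<longlonglongrightarrow>
        (\<integral>s. indicator (subtree (list_decode i)) s \<partial>measure_pmf p :: real)"
      by (rule lim[of _ 1]) (auto simp: indicator_def)
    then show "(\<lambda>k. point (P k) i) \<longlonglongrightarrow> point p i" by (simp add: point_def)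
  qed
  then have "(\<lambda>k. g (point (P k))) \<longlonglongrightarrow> g (point p)"
    using assms(3) point_in_simplex[OF sub]
    by (intro continuous_on_tendsto_compose[OF assms(2)] eventuallyI) (auto intro!: point_in_simplex)
  moreover have "(\<lambda>k. g (point (P k))) \<longlonglongrightarrow> (\<integral>s. g (vertex s) \<partial>measure_pmf p)"
  proof -
    obtain B where "\<And>x. x \<in> tree_simplex \<Longrightarrow> \<bar>g x\<bar> \<le> B" using bounded_on_simplex[OF assms(2)] by blast
    then show ?thesis
      unfolding affine_point_finite[OF assms(1) fin sub] by (intro lim[of _ B]) auto
  qed
  ultimately show ?thesis by (rule LIMSEQ_unique)
qed

text \<open>
  The coordinates of a vertex are \<open>0\<close> or \<open>1\<close>, hence it is extreme even in the cube.
\<close>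
lemma vertex_extreme: "s \<in> Tr \<Longrightarrow> vertex s extreme_point_of tree_simplex"
  unfolding extreme_point_of_def
proof (intro conjI ballI notI vertex_in_simplex)
  fix a b assume s: "s \<in> Tr" and ab: "a \<in> tree_simplex" "b \<in> tree_simplex" and "vertex s \<in> open_segment a b"
  then obtain u where u: "a \<noteq> b" "0 < u" "u < 1" "vertex s = (1 - u) *\<^sub>R a + u *\<^sub>R b"
    by (auto simp: in_segment)
  have "a i = b i" for i
  proof -
    have *: "0 \<le> a i" "a i \<le> 1" "0 \<le> b i" "b i \<le> 1"
      using coord_bounds[OF ab(1), of "list_decode i"] coord_bounds[OF ab(2), of "list_decode i"] by auto
    have eq: "vertex s i = (1 - u) * a i + u * b i"
      by (simp add: u(4) scaleR_fun_def plus_fun_def)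
    have "vertex s i = 0 \<or> vertex s i = 1"
      using coord_vertex[OF s, of "list_decode i"] by (auto simp: indicator_def split: if_splits)
    then show ?thesis
    proof
      assume "vertex s i = 0"
      then have "(1 - u) * a i = 0 \<and> u * b i = 0"
        using eq * u by (metis add_nonneg_eq_0_iff diff_ge_0_iff_ge less_imp_le mult_nonneg_nonneg)
      then show ?thesis using u by auto
    next
      assume "vertex s i = 1"
      then have "(1 - u) * (1 - a i) + u * (1 - b i) = 0" using eq by (simp add: algebra_simps)
      moreover have "0 \<le> (1 - u) * (1 - a i)" "0 \<le> u * (1 - b i)" using * u by auto
      ultimately have "(1 - u) * (1 - a i) = 0 \<and> u * (1 - b i) = 0" by linarith
      then show ?thesis using u by auto
    qed
  qed
  with u(1) show False by auto
qed

text \<open>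
  If the law has an atom \<open>s\<close> of mass \<open>c < 1\<close>, the point lies strictly between \<open>vertex s\<close> and the point
  of the law conditioned on the other nodes.
\<close>
lemma extreme_imp_vertex:
  assumes "x extreme_point_of tree_simplex"
  shows "x \<in> vertex ` Tr"
proof -
  have x: "x \<in> tree_simplex" using assms by (simp add: extreme_point_of_def)
  obtain p where p: "set_pmf p \<subseteq> Tr" "x = point p" using simplex_pointE[OF x] .
  obtain s where s: "s \<in> set_pmf p" using set_pmf_not_empty[of p] by blast
  then have sT: "s \<in> Tr" using p by auto
  define c where "c = pmf p s"
  have c0: "0 < c" "c \<le> 1" using s by (auto simp: c_def pmf_positive pmf_le_1)
  show ?thesis
  proof (cases "c = 1")
    case True
    then have "p = return_pmf s"
      by (metis c_def measure_pmf_single measure_pmf.prob_eq_1 AE_measure_pmf_iff set_pmf_subset_singleton singletonD singletonI subsetI sets_measure_pmf UNIV_I)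
    then have "x = vertex s" using p sT by (simp add: vertex_def)
    then show ?thesis using sT by auto
  next
    case False
    then have c: "0 < c" "c < 1" using c0 by auto
    have prob: "measure_pmf.prob p (-{s}) = 1 - c"
      by (simp add: c_def measure_pmf.prob_compl[of "{s}" p, simplified] Compl_eq_Diff_UNIV measure_pmf_single)
    then have ne: "set_pmf p \<inter> -{s} \<noteq> {}"
      using c by (metis measure_pmf_zero_iff diff_gt_0_iff_gt less_irrefl)
    define q where "q = cond_pmf p (-{s})"
    have q: "pmf q t = (if t = s then 0 else pmf p t / (1 - c))" for t
      unfolding q_def by (simp add: pmf_cond[OF ne] prob)
    have qT: "set_pmf q \<subseteq> Tr" unfolding q_def using p by (simp add: set_cond_pmf[OF ne]) blast
    have p_mix: "p = bind_pmf (bernoulli_pmf c) (\<lambda>b. if b then return_pmf s else q)"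
    proof (rule pmf_eqI)
      fix t show "pmf p t = pmf (bind_pmf (bernoulli_pmf c) (\<lambda>b. if b then return_pmf s else q)) t"
        using c by (simp add: pmf_bind q indicator_def c_def[symmetric])
    qed
    have mix: "measure_pmf.prob p A = c * indicator A s + (1 - c) * measure_pmf.prob q A" for A
    proof -
      have "ennreal (measure_pmf.prob p A) =
          ennreal c * indicator A s + ennreal (1 - c) * ennreal (measure_pmf.prob q A)"
        unfolding measure_pmf.emeasure_eq_measure[symmetric]
        by (subst p_mix) (use c in \<open>simp add: nn_integral_bernoulli_pmf mult.commute\<close>)
      also have "\<dots> = ennreal (c * indicator A s + (1 - c) * measure_pmf.prob q A)"
        using c by (auto simp: indicator_def ennreal_plus ennreal_mult simp flip: ennreal_1)
      finally show ?thesis using c by (subst (asm) ennreal_inj) auto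
    qed
    have "x = (1 - c) *\<^sub>R point q + c *\<^sub>R vertex s"
    proof
      fix i show "x i = ((1 - c) *\<^sub>R point q + c *\<^sub>R vertex s) i"
        using coord_vertex[OF sT, of "list_decode i"]
        by (simp add: p(2) point_def scaleR_fun_def plus_fun_def mix)
    qed
    moreover have "point q \<noteq> vertex s"
      using sT q[of s] by (auto simp: vertex_def)
    ultimately have "x \<in> open_segment (point q) (vertex s)"
      using c by (auto simp: in_segment)
    moreover have "point q \<in> tree_simplex" using qT by (rule point_in_simplex)
    ultimately show ?thesis using assms by (auto simp: extreme_point_of_def)
  qed
qed

lemma extreme_points: "{y. y extreme_point_of tree_simplex} = vertex ` Tr"
  using vertex_extreme extreme_imp_vertex by auto

lemma singleton_measurable: "x \<in> tree_simplex \<Longrightarrow> {x} \<in> sets (borel_of X)"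
proof -
  assume x: "x \<in> tree_simplex"
  then have "openin X (tree_simplex - {x})"
    by (auto simp: openin_open intro!: exI[of _ "-{x}"])
  then have "tree_simplex - {x} \<in> sets (borel_of X)"
    by (auto simp: sets_borel_of_X intro: sigma_sets.Basic)
  then have "space (borel_of X) - (tree_simplex - {x}) \<in> sets (borel_of X)" by (rule sets.compl_sets)
  moreover have "space (borel_of X) - (tree_simplex - {x}) = {x}" using x by auto
  ultimately show ?thesis by simp
qed

text \<open>
  The image of the law of \<open>x\<close> under \<open>vertex\<close> represents \<open>x\<close>.  Conversely, a representing measure \<open>\<nu>\<close> on
  the countable set of vertices is determined by its atoms, and since \<open>mass y s\<close> is the indicator of
  \<open>vertex s\<close> there, \<open>nn_integral_mass\<close> gives the atom at \<open>vertex s\<close> the mass \<open>mass x s\<close>.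
\<close>
lemma metrizable_Choquet_simplex: "metrizable_Choquet_simplex euclidean tree_simplex"
  unfolding metrizable_Choquet_simplex_def
proof (intro conjI ballI)
  show "tree_simplex \<noteq> {}" using vertex_in_simplex by blast
  show "metrizable_space X" by (intro metrizable_space_subtopology metrizable_space_euclidean)
  fix x assume x: "x \<in> tree_simplex"
  define p where "p = law x"
  have p: "set_pmf p \<subseteq> Tr" "point p = x" using x simplex_law by (auto simp: p_def)
  define \<mu> where "\<mu> = distr (measure_pmf p) (borel_of X) vertex"
  have V: "vertex ` A \<in> sets (borel_of X)" for A
  proof (rule sets.countable)
    fix y assume "y \<in> vertex ` A"
    then show "{y} \<in> sets (borel_of X)" using vertex_in_simplex by (intro singleton_measurable) blast
  qed simp
  have \<mu>: "borel_prob X \<mu>"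
    unfolding borel_prob_def \<mu>_def by (auto intro: measure_pmf.prob_space_distr)
  show "\<exists>!\<mu>. borel_prob X \<mu> \<and> is_barycenter X \<mu> x \<and> emeasure \<mu> {y. y extreme_point_of tree_simplex} = 1"
  proof (rule ex1I[of _ \<mu>], intro conjI \<mu>)
    show "is_barycenter X \<mu> x"
      unfolding is_barycenter_def
    proof (intro conjI allI impI)
      fix g assume "continuous_map X euclideanreal g \<and> affine_map_on (topspace X) g"
      then have g: "continuous_map X euclideanreal g" "affine_map_on (topspace X) g" by auto
      have "(\<integral>y. g y \<partial>\<mu>) = (\<integral>s. g (vertex s) \<partial>measure_pmf p)"
        unfolding \<mu>_def by (intro integral_distr continuous_borel_of g) auto
      then show "g x = (\<integral>y. g y \<partial>\<mu>)"
        using affine_point[of g p] g p by simp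
    qed (use x in auto)
    have "emeasure \<mu> (vertex ` Tr) = emeasure (measure_pmf p) (vertex -` vertex ` Tr)"
      unfolding \<mu>_def using V by (subst emeasure_distr) auto
    also have "\<dots> = 1"
      using p by (subst measure_pmf.emeasure_eq_1_AE) (auto simp: AE_measure_pmf_iff)
    finally show "emeasure \<mu> {y. y extreme_point_of tree_simplex} = 1"
      by (simp add: extreme_points)
    fix \<nu> assume \<nu>: "borel_prob X \<nu> \<and> is_barycenter X \<nu> x \<and> emeasure \<nu> {y. y extreme_point_of tree_simplex} = 1"
    have "is_barycenter X \<mu> x" "emeasure \<mu> {y. y extreme_point_of tree_simplex} = 1" by fact+
    have ae: "AE y in \<nu>. y \<in> vertex ` Tr" if "borel_prob X \<nu>" "emeasure \<nu> (vertex ` Tr) = 1" for \<nu>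
    proof -
      interpret prob_space \<nu> using that by (simp add: borel_prob_def)
      show ?thesis
        using that V[of Tr] by (subst prob_eq_1[symmetric]) (auto simp: borel_prob_def emeasure_eq_measure)
    qed
    have *: "emeasure \<nu> {vertex s} = ennreal (mass x s)"
      if "s \<in> Tr" "borel_prob X \<nu>" "is_barycenter X \<nu> x" "emeasure \<nu> (vertex ` Tr) = 1" for s \<nu>
    proof -
      interpret prob_space \<nu> using that by (simp add: borel_prob_def)
      have sets: "sets \<nu> = sets (borel_of X)" using that by (simp add: borel_prob_def)
      have "AE y in \<nu>. y \<in> vertex ` Tr"
        using that by (intro ae)
      then have "AE y in \<nu>. ennreal (mass y s) = indicator {vertex s} y"
        by eventually_elim (use that(1) in \<open>auto simp: mass_vertex indicator_def vertex_eq_iff\<close>)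
      then have "(\<integral>\<^sup>+y. ennreal (mass y s) \<partial>\<nu>) = (\<integral>\<^sup>+y. indicator {vertex s} y \<partial>\<nu>)"
        by (rule nn_integral_cong_AE)
      also have "\<dots> = emeasure \<nu> {vertex s}"
        by (intro nn_integral_indicator) (simp add: sets singleton_measurable)
      finally show ?thesis using nn_integral_mass[OF that(2,3)] by simp
    qed
    show "\<nu> = \<mu>"
    proof (rule measure_eqI)
      show sets: "sets \<nu> = sets \<mu>" using \<nu> \<mu> by (simp add: borel_prob_def)
      fix A assume "A \<in> sets \<nu>"
      have **: "emeasure \<nu>' A = (\<integral>\<^sup>+y. emeasure \<nu>' {y} \<partial>count_space (A \<inter> vertex ` Tr))"
        if "sets \<nu>' = sets \<nu>" "AE y in \<nu>'. y \<in> vertex ` Tr" for \<nu>'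
      proof -
        have "emeasure \<nu>' A = emeasure \<nu>' (A \<inter> vertex ` Tr)"
          using that \<open>A \<in> sets \<nu>\<close> V[of Tr] \<nu> by (intro emeasure_eq_AE) (auto simp: borel_prob_def)
        also have "\<dots> = (\<integral>\<^sup>+y. emeasure \<nu>' {y} \<partial>count_space (A \<inter> vertex ` Tr))"
        proof (rule emeasure_countable_singleton)
          fix y assume "y \<in> A \<inter> vertex ` Tr"
          then have "y \<in> tree_simplex" using vertex_in_simplex by blast
          then show "{y} \<in> sets \<nu>'"
            using that(1) \<nu> singleton_measurable by (simp add: borel_prob_def)
        qed (simp add: countable_Int2)
        finally show ?thesis .
      qed
      have "emeasure \<nu> A = (\<integral>\<^sup>+y. emeasure \<nu> {y} \<partial>count_space (A \<inter> vertex ` Tr))"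
        using \<nu> by (intro **) (simp_all add: ae extreme_points)
      also have "\<dots> = (\<integral>\<^sup>+y. emeasure \<mu> {y} \<partial>count_space (A \<inter> vertex ` Tr))"
        using \<nu> \<mu> \<open>is_barycenter X \<mu> x\<close> \<open>emeasure \<mu> {y. y extreme_point_of tree_simplex} = 1\<close>
        by (intro nn_integral_cong) (auto simp: extreme_points *)
      also have "\<dots> = emeasure \<mu> A"
        using ae[OF \<mu>] \<open>emeasure \<mu> {y. y extreme_point_of tree_simplex} = 1\<close> sets
        by (intro **[symmetric]) (simp_all add: extreme_points)
      finally show "emeasure \<nu> A = emeasure \<mu> A" .
    qed
  qed
qed (simp_all add: hausdorff_locally_convex_product compact_simplex convex_simplex)

end

context wf_tree
begin

section \<open>Envelopes on the simplex\<close>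

text \<open>
  Upper semicontinuity on the space of nodes.
\<close>
definition usc_tree :: "(nat list \<Rightarrow> real) \<Rightarrow> bool" where
  "usc_tree \<Phi> \<longleftrightarrow> (\<forall>s\<in>Tr. \<forall>\<epsilon>>0. \<exists>N. \<forall>n\<ge>N. \<forall>t\<in>Tr. t \<in> subtree (n # s) \<longrightarrow> \<Phi> t \<le> \<Phi> s + \<epsilon>)"

definition subtree_integral :: "(nat list \<Rightarrow> real) \<Rightarrow> nat list \<Rightarrow> (nat \<Rightarrow> real) \<Rightarrow> real" where
  "subtree_integral \<Phi> s y = (\<integral>t. \<Phi> t * indicator (subtree s) t \<partial>measure_pmf (law y))"

lemma integrable_law:
  assumes "\<And>s. 0 \<le> \<Phi> s" "\<And>s. \<Phi> s \<le> B"
  shows "integrable (measure_pmf p) (\<lambda>t. \<Phi> t * indicator A t :: real)"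
proof (rule measure_pmf.integrable_const_bound)
  have "0 \<le> B" using assms[of undefined] by linarith
  then show "AE t in measure_pmf p. norm (\<Phi> t * indicator A t) \<le> B"
    using assms by (auto simp: indicator_def)
qed simp

lemma har_eq_subtree_integral:
  assumes "\<And>s. 0 \<le> \<Phi> s" "\<And>s. \<Phi> s \<le> B"
  shows "har \<Phi> y = ennreal (subtree_integral \<Phi> [] y)"
  using integrable_law[of \<Phi> B "law y" UNIV, OF assms] assms(1)
  unfolding har_def subtree_integral_def by (subst nn_integral_eq_integral) auto

lemma subtree_integral_split:
  assumes "\<And>s. 0 \<le> \<Phi> s" "\<And>s. \<Phi> s \<le> B"
  shows "subtree_integral \<Phi> s y = (\<Sum>n<N. subtree_integral \<Phi> (n # s) y)
    + (\<integral>t. \<Phi> t * indicator (subtree s - (\<Union>n<N. subtree (n # s))) t \<partial>measure_pmf (law y))"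
proof -
  have "indicator (subtree s) t = (\<Sum>n<N. indicator (subtree (n # s)) t)
      + (indicator (subtree s - (\<Union>n<N. subtree (n # s))) t :: real)" for t
  proof -
    have "(\<Sum>n<N. indicator (subtree (n # s)) t) = (indicator (\<Union>n<N. subtree (n # s)) t :: real)"
      using disjoint_subtrees[of s]
      by (intro indicator_UN_disjoint[symmetric]) (auto simp: disjoint_family_on_def)
    then show ?thesis using subtree_Cons_subset[of _ s] by (auto simp: indicator_def)
  qed
  then have "subtree_integral \<Phi> s y = (\<integral>t. (\<Sum>n<N. \<Phi> t * indicator (subtree (n # s)) t)
      + \<Phi> t * indicator (subtree s - (\<Union>n<N. subtree (n # s))) t \<partial>measure_pmf (law y))"
    unfolding subtree_integral_def by (simp add: distrib_left sum_distrib_left)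
  also have "\<dots> = (\<Sum>n<N. subtree_integral \<Phi> (n # s) y)
    + (\<integral>t. \<Phi> t * indicator (subtree s - (\<Union>n<N. subtree (n # s))) t \<partial>measure_pmf (law y))"
    unfolding subtree_integral_def using integrable_law[of \<Phi> B, OF assms]
    by (subst Bochner_Integration.integral_add)
      (simp_all only: Bochner_Integration.integral_sum Bochner_Integration.integrable_sum)
  finally show ?thesis .
qed

lemma prob_rest:
  assumes "y \<in> tree_simplex"
  shows "measure_pmf.prob (law y) (subtree s - (\<Union>n<N. subtree (n # s)))
    = coord y s - (\<Sum>n<N. coord y (n # s))"
proof -
  have "subtree_integral (\<lambda>_. 1) s y = (\<Sum>n<N. subtree_integral (\<lambda>_. 1) (n # s) y)
    + measure_pmf.prob (law y) (subtree s - (\<Union>n<N. subtree (n # s)))"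
    by (subst subtree_integral_split[of _ 1]) auto
  then show ?thesis by (simp add: subtree_integral_def prob_law[OF assms])
qed

text \<open>
  Harmonic extensions of upper semicontinuous functions are infima of continuous affine functions.  By
  induction on the tree: choose majorants on the first \<open>N\<close> subtrees of \<open>s\<close>, and use the constant
  \<open>\<Phi> s + \<epsilon> / 3\<close> on the rest of the subtree of \<open>s\<close>, whose mass is the continuous function
  \<open>coord y s - (\<Sum>n<N. coord y (n # s))\<close>.
\<close>
lemma subtree_majorant:
  assumes "usc_tree \<Phi>" and nonneg: "\<And>s. 0 \<le> \<Phi> s" and bounded: "\<And>s. \<Phi> s \<le> B"
    and "x \<in> tree_simplex" "s \<in> Tr" "0 < \<epsilon>"
  shows "\<exists>g. continuous_on UNIV g \<and> (\<forall>y\<in>tree_simplex. subtree_integral \<Phi> s y \<le> g y) \<and> g x \<le> subtree_integral \<Phi> s x + \<epsilon>"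
  using assms(5,6)
proof (induction s arbitrary: \<epsilon> rule: tree_induct)
  case (node s \<epsilon>)
  have B: "0 \<le> B" using nonneg[of s] bounded[of s] by linarith
  obtain N1 where N1: "\<And>n t. N1 \<le> n \<Longrightarrow> t \<in> Tr \<Longrightarrow> t \<in> subtree (n # s) \<Longrightarrow> \<Phi> t \<le> \<Phi> s + \<epsilon> / 3"
    using assms(1) node.hyps node.prems unfolding usc_tree_def by (meson divide_pos_pos zero_less_numeral)
  \<comment> \<open>The error \<open>\<epsilon>\<close> is shared by the rest (\<open>\<epsilon> / 3\<close>), the mass of the rest outside \<open>s\<close> (\<open>\<delta>\<close>) and the \<open>N\<close> subtrees (\<open>\<eta>\<close> each).\<close>
  define \<delta> where "\<delta> = \<epsilon> / (3 * (B + 1))"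
  have \<delta>: "0 < \<delta>" "B * \<delta> \<le> \<epsilon> / 3"
    using B node.prems by (auto simp: \<delta>_def field_simps)
  have "(\<lambda>N. \<Sum>n<N. coord x (n # s)) \<longlonglongrightarrow> coord x s - mass x s"
    using mass_nonneg_and_sums(2)[OF assms(4), of s] by (simp add: sums_def)
  then have "eventually (\<lambda>N. coord x s - mass x s - \<delta> < (\<Sum>n<N. coord x (n # s))) sequentially"
    using \<delta> by (intro order_tendstoD) auto
  then obtain N2 where N2: "\<And>N. N2 \<le> N \<Longrightarrow> coord x s - mass x s - \<delta> < (\<Sum>n<N. coord x (n # s))"
    by (auto simp: eventually_sequentially)
  define N where "N = max N1 N2"
  define R where "R = subtree s - (\<Union>n<N. subtree (n # s))"
  define \<eta> where "\<eta> = \<epsilon> / (3 * (real N + 1))"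
  have \<eta>: "0 < \<eta>" "N * \<eta> \<le> \<epsilon> / 3"
    using node.prems by (auto simp: \<eta>_def field_simps)
  have "\<exists>g. continuous_on UNIV g \<and> (\<forall>y\<in>tree_simplex. subtree_integral \<Phi> (n # s) y \<le> g y) \<and> g x \<le> subtree_integral \<Phi> (n # s) x + \<eta>" for n
  proof (cases "n # s \<in> Tr")
    case False
    have "subtree_integral \<Phi> (n # s) y = 0" if "y \<in> tree_simplex" for y
    proof -
      have "AE t in measure_pmf (law y). \<Phi> t * indicator (subtree (n # s)) t = 0"
        using simplex_law(1)[OF that] False subtree_Tr[of _ "n # s"]
        by (auto simp: AE_measure_pmf_iff indicator_def)
      then show ?thesis unfolding subtree_integral_def by (rule integral_eq_zero_AE)
    qed
    then show ?thesis using \<eta> assms(4) by (intro exI[of _ "\<lambda>_. 0"]) auto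
  qed (use node.IH \<eta> in auto)
  then obtain g where g: "\<And>n. continuous_on UNIV (g n)"
    "\<And>n y. y \<in> tree_simplex \<Longrightarrow> subtree_integral \<Phi> (n # s) y \<le> g n y" "\<And>n. g n x \<le> subtree_integral \<Phi> (n # s) x + \<eta>"
    by metis
  define G where "G y = (\<Sum>n<N. g n y) + (\<Phi> s + \<epsilon> / 3) * (coord y s - (\<Sum>n<N. coord y (n # s)))" for y
  have split: "subtree_integral \<Phi> s y = (\<Sum>n<N. subtree_integral \<Phi> (n # s) y) + (\<integral>t. \<Phi> t * indicator R t \<partial>measure_pmf (law y))" for y
    unfolding R_def by (rule subtree_integral_split[OF nonneg bounded])
  show ?case
  proof (intro exI[of _ G] conjI ballI)
    show "continuous_on UNIV G"
      unfolding G_def by (intro continuous_intros g continuous_on_product_coordinates)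
    fix y assume y: "y \<in> tree_simplex"
    have "(\<integral>t. \<Phi> t * indicator R t \<partial>measure_pmf (law y)) \<le> (\<integral>t. (\<Phi> s + \<epsilon> / 3) * indicator R t \<partial>measure_pmf (law y))"
    proof (rule integral_mono_AE)
      show "AE t in measure_pmf (law y). \<Phi> t * indicator R t \<le> (\<Phi> s + \<epsilon> / 3) * indicator R t"
      proof (subst AE_measure_pmf_iff, rule ballI)
        fix t assume "t \<in> set_pmf (law y)"
        then have t: "t \<in> Tr" using simplex_law(1)[OF y] by auto
        have "\<Phi> t \<le> \<Phi> s + \<epsilon> / 3" if "t \<in> R"
        proof (cases "t = s")
          case False
          moreover have "t \<in> insert s (\<Union>n. subtree (n # s))"
            unfolding subtree_split[symmetric] using that by (simp add: R_def)
          ultimately obtain n where n: "t \<in> subtree (n # s)" by auto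
          then have "n \<ge> N" using that by (auto simp: R_def not_less[symmetric])
          with n have "t \<in> subtree (n # s)" "n \<ge> N" by auto
          then show ?thesis using N1 t by (auto simp: N_def)
        qed (use node.prems in auto)
        then show "\<Phi> t * indicator R t \<le> (\<Phi> s + \<epsilon> / 3) * indicator R t" by (auto simp: indicator_def)
      qed
    qed (use integrable_law[of \<Phi> B, OF nonneg bounded] integrable_law[of "\<lambda>_. \<Phi> s + \<epsilon> / 3" "\<Phi> s + \<epsilon> / 3"] nonneg node.prems in auto)
    also have "\<dots> = (\<Phi> s + \<epsilon> / 3) * (coord y s - (\<Sum>n<N. coord y (n # s)))"
      using prob_rest[OF y, of s N] by (simp add: R_def)
    finally show "subtree_integral \<Phi> s y \<le> G y"
      unfolding split G_def using g(2)[OF y] by (intro add_mono sum_mono)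
  next
    let ?q = "coord x s - (\<Sum>n<N. coord x (n # s))"
    have q: "?q \<le> mass x s + \<delta>" "0 \<le> ?q" "?q \<le> 1"
    proof -
      show "?q \<le> mass x s + \<delta>" using N2[of N] by (simp add: N_def)
      show "0 \<le> ?q" "?q \<le> 1"
        unfolding prob_rest[OF assms(4), symmetric] by (rule measure_nonneg, rule measure_pmf.prob_le_1)
    qed
    have "(\<Phi> s + \<epsilon> / 3) * ?q \<le> \<Phi> s * (mass x s + \<delta>) + \<epsilon> / 3 * 1"
      unfolding distrib_right using q nonneg node.prems by (intro add_mono mult_left_mono) auto
    also have "\<dots> \<le> \<Phi> s * mass x s + \<epsilon> / 3 + \<epsilon> / 3"
    proof -
      have "\<Phi> s * \<delta> \<le> B * \<delta>" using bounded[of s] \<delta> by (intro mult_right_mono) auto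
      then show ?thesis using \<delta>(2) by (simp add: distrib_left)
    qed
    also have "\<Phi> s * mass x s \<le> (\<integral>t. \<Phi> t * indicator R t \<partial>measure_pmf (law x))"
    proof -
      have "\<Phi> s * mass x s = (\<integral>t. \<Phi> s * indicator {s} t \<partial>measure_pmf (law x))"
        by (simp add: pmf_law[OF assms(4)] measure_pmf_single)
      also have "\<dots> \<le> (\<integral>t. \<Phi> t * indicator R t \<partial>measure_pmf (law x))"
      proof (rule integral_mono)
        show "integrable (measure_pmf (law x)) (\<lambda>t. \<Phi> t * indicator R t)"
          by (rule integrable_law[of \<Phi> B, OF nonneg bounded])
        show "integrable (measure_pmf (law x)) (\<lambda>t. \<Phi> s * indicator {s} t)"
          by (rule integrable_law[of _ "\<Phi> s"]) (auto simp: nonneg)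
        show "\<Phi> s * indicator {s} t \<le> \<Phi> t * indicator R t" for t
          using nonneg[of t] by (auto simp: indicator_def R_def)
      qed
      finally show ?thesis .
    qed
    finally have 1: "(\<Phi> s + \<epsilon> / 3) * ?q \<le> (\<integral>t. \<Phi> t * indicator R t \<partial>measure_pmf (law x)) + \<epsilon> / 3 + \<epsilon> / 3"
      by simp
    have "(\<Sum>n<N. g n x) \<le> (\<Sum>n<N. subtree_integral \<Phi> (n # s) x + \<eta>)" by (intro sum_mono g)
    also have "\<dots> \<le> (\<Sum>n<N. subtree_integral \<Phi> (n # s) x) + \<epsilon> / 3" using \<eta> by (simp add: sum.distrib)
    finally show "G x \<le> subtree_integral \<Phi> s x + \<epsilon>"
      unfolding split G_def using 1 by linarith
  qed
qed

lemma har_majorant: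
  assumes "usc_tree \<Phi>" "\<And>s. 0 \<le> \<Phi> s" "\<And>s. \<Phi> s \<le> B" "x \<in> tree_simplex" "0 < \<epsilon>"
  obtains g where "continuous_on UNIV g" "\<And>y. y \<in> tree_simplex \<Longrightarrow> 0 \<le> g y"
    "\<And>y. y \<in> tree_simplex \<Longrightarrow> har \<Phi> y \<le> ennreal (g y)" "ennreal (g x) \<le> har \<Phi> x + ennreal \<epsilon>"
proof -
  obtain g where g: "continuous_on UNIV g" "\<And>y. y \<in> tree_simplex \<Longrightarrow> subtree_integral \<Phi> [] y \<le> g y" "g x \<le> subtree_integral \<Phi> [] x + \<epsilon>"
    using subtree_majorant[OF assms(1-4) root assms(5)] by blast
  have nonneg: "0 \<le> subtree_integral \<Phi> [] y" for y
    unfolding subtree_integral_def using assms(2) by (intro integral_nonneg_AE) auto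
  show ?thesis
  proof (rule that)
    show "0 \<le> g y" if "y \<in> tree_simplex" for y using g(2)[OF that] nonneg[of y] by linarith
    show "har \<Phi> y \<le> ennreal (g y)" if "y \<in> tree_simplex" for y
      unfolding har_eq_subtree_integral[OF assms(2,3)] using g(2)[OF that] by (rule ennreal_leI)
    have "ennreal (g x) \<le> ennreal (subtree_integral \<Phi> [] x + \<epsilon>)" using g(3) by (rule ennreal_leI)
    then show "ennreal (g x) \<le> har \<Phi> x + ennreal \<epsilon>"
      unfolding har_eq_subtree_integral[OF assms(2,3)] using nonneg[of x] assms(5) by (simp add: ennreal_plus)
  qed (rule g(1))
qed

lemma har_le: "(\<And>s. \<Phi> s \<le> B) \<Longrightarrow> har \<Phi> x \<le> ennreal B"
  unfolding har_def
  by (rule order_trans[OF nn_integral_mono[of _ _ "\<lambda>_. ennreal B"]]) (auto simp: ennreal_leI measure_pmf.emeasure_space_1)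

lemma usc_har:
  assumes "usc_tree \<Phi>" "\<And>s. 0 \<le> \<Phi> s" "\<And>s. \<Phi> s \<le> B"
  shows "usc X (har \<Phi>)"
  unfolding usc_def
proof
  fix c :: ennreal
  let ?G = "{g. continuous_on UNIV g \<and> (\<forall>y\<in>tree_simplex. har \<Phi> y \<le> ennreal (g y))}"
  have "{x \<in> topspace X. har \<Phi> x < c} = (\<Union>g\<in>?G. tree_simplex \<inter> {x. ennreal (g x) < c})"
  proof (intro equalityI subsetI)
    fix x assume "x \<in> {x \<in> topspace X. har \<Phi> x < c}"
    then have x: "x \<in> tree_simplex" "har \<Phi> x < c" by auto
    have fin: "har \<Phi> x < \<top>" using har_le[of \<Phi> B x, OF assms(3)] by (simp add: order_le_less_trans)
    obtain \<epsilon> :: real where \<epsilon>: "0 < \<epsilon>" "har \<Phi> x + ennreal \<epsilon> < c"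
    proof -
      obtain d where d: "har \<Phi> x < d" "d < c" using dense x(2) by blast
      then have "d \<noteq> \<top>" by auto
      define \<epsilon> where "\<epsilon> = enn2real (d - har \<Phi> x)"
      have dx: "0 < d - har \<Phi> x" "d - har \<Phi> x < \<top>" using d \<open>d \<noteq> \<top>\<close>
        using ennreal_minus_eq_top[of d "har \<Phi> x"] by (auto simp: diff_gt_0_iff_gt_ennreal less_top[symmetric])
      then have "ennreal \<epsilon> = d - har \<Phi> x" by (simp add: \<epsilon>_def)
      then have "har \<Phi> x + ennreal \<epsilon> = d" using d by (simp add: add_diff_inverse_ennreal less_imp_le)
      moreover have "0 < \<epsilon>" using dx by (simp add: \<epsilon>_def enn2real_positive_iff)
      ultimately show ?thesis using that[of \<epsilon>] d by metis
    qed
    from har_majorant[OF assms x(1) \<epsilon>(1)] obtain g where "continuous_on UNIV g"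
      "\<And>y. y \<in> tree_simplex \<Longrightarrow> har \<Phi> y \<le> ennreal (g y)" "ennreal (g x) \<le> har \<Phi> x + ennreal \<epsilon>" by metis
    then show "x \<in> (\<Union>g\<in>?G. tree_simplex \<inter> {x. ennreal (g x) < c})"
      using x \<epsilon>(2) by (auto intro!: exI[of _ g])
  qed (auto intro: order_le_less_trans)
  moreover have "open {x. ennreal (g x) < c}" if "g \<in> ?G" for g
    using that by (intro open_Collect_less continuous_intros) (auto intro: continuous_on_ennreal)
  ultimately show "openin X {x \<in> topspace X. har \<Phi> x < c}"
    by (auto intro!: openin_Union openin_open_Int)
qed

lemma envelope_le_har:
  assumes "usc_tree \<Phi>" "\<And>s. 0 \<le> \<Phi> s" "\<And>s. \<Phi> s \<le> B" "x \<in> tree_simplex"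
    and "\<And>y. y \<in> tree_simplex \<Longrightarrow> f y \<le> har \<Phi> y"
  shows "usc_envelope X f x \<le> har \<Phi> x"
proof (rule ennreal_le_epsilon)
  fix \<epsilon> :: real assume "0 < \<epsilon>"
  from har_majorant[OF assms(1-4) this] obtain g where g: "continuous_on UNIV g" "\<And>y. y \<in> tree_simplex \<Longrightarrow> 0 \<le> g y"
    "\<And>y. y \<in> tree_simplex \<Longrightarrow> har \<Phi> y \<le> ennreal (g y)" "ennreal (g x) \<le> har \<Phi> x + ennreal \<epsilon>" by metis
  have "bounded_on (topspace X) f"
    unfolding bounded_on_def using assms(5) har_le[of \<Phi> B, OF assms(3)] by (auto intro!: exI[of _ B] intro: order_trans)
  then have "usc_envelope X f x \<le> ennreal (g x)"
    unfolding usc_envelope_def using g assms(5)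
    by (auto intro!: INF_lower intro: order_trans continuous_on_subset)
  with g(4) show "usc_envelope X f x \<le> har \<Phi> x + ennreal \<epsilon>" by (rule order_trans[rotated])
qed

lemma envelope_mono:
  assumes "\<And>y. y \<in> tree_simplex \<Longrightarrow> f y \<le> f' y"
  shows "usc_envelope X f x \<le> usc_envelope X f' x"
proof -
  have "bounded_on tree_simplex f" if "bounded_on tree_simplex f'"
    using that assms unfolding bounded_on_def by (meson order_trans)
  then show ?thesis
    using assms unfolding usc_envelope_def by (auto intro!: INF_superset_mono intro: order_trans)
qed

text \<open>
  Upper envelopes see all limits of values, and these are the only lower bounds that are needed.
\<close>
lemma envelope_ge_limit:
  assumes "z \<longlonglongrightarrow> x" "\<And>n. z n \<in> tree_simplex" "x \<in> tree_simplex"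
    and "eventually (\<lambda>n. c \<le> f (z n)) sequentially"
  shows "c \<le> usc_envelope X f x"
proof (cases "bounded_on tree_simplex f")
  case True
  have "c \<le> ennreal (g x)" if g: "continuous_on tree_simplex g" "\<forall>y\<in>tree_simplex. f y \<le> ennreal (g y)" for g
  proof (rule tendsto_lowerbound)
    have "(\<lambda>n. g (z n)) \<longlonglongrightarrow> g x"
      using assms by (intro continuous_on_tendsto_compose[OF g(1)]) auto
    then show "(\<lambda>n. ennreal (g (z n))) \<longlonglongrightarrow> ennreal (g x)" by (rule tendsto_ennrealI)
    show "eventually (\<lambda>n. c \<le> ennreal (g (z n))) sequentially"
      using assms(4) by eventually_elim (use g(2) assms(2) in \<open>auto intro: order_trans\<close>)
  qed auto
  then show ?thesis using True by (auto simp: usc_envelope_def intro!: INF_greatest)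
qed (simp add: usc_envelope_def)

section \<open>Moving mass to far children\<close>

definition push :: "nat list set \<Rightarrow> nat \<Rightarrow> nat list \<Rightarrow> nat list" where
  "push S n s = (if s \<in> S then n # s else s)"

definition pushed :: "nat list set \<Rightarrow> (nat \<Rightarrow> real) \<Rightarrow> nat \<Rightarrow> nat \<Rightarrow> real" where
  "pushed S x n = point (map_pmf (push S n) (law x))"

lemma pushed_in_simplex:
  assumes "x \<in> tree_simplex" "\<And>s n. s \<in> S \<Longrightarrow> n # s \<in> Tr"
  shows "pushed S x n \<in> tree_simplex"
  unfolding pushed_def using simplex_law(1)[OF assms(1)] assms(2)
  by (intro point_in_simplex) (auto simp: push_def)

text \<open>
  The mass moved from \<open>s\<close> enters no other subtree than that of \<open>n # s\<close>, so each single coordinate changes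
  for at most one \<open>n\<close>.
\<close>
lemma pushed_tendsto:
  assumes "x \<in> tree_simplex"
  shows "pushed S x \<longlonglongrightarrow> x"
proof (rule tendsto_fun)
  fix i
  let ?t = "list_decode i"
  have "eventually (\<lambda>n. pushed S x n i = x i) sequentially"
    using eventually_gt_at_top[of "if ?t = [] then 0 else hd ?t"]
  proof eventually_elim
    case (elim n)
    have "push S n -` subtree ?t = subtree ?t"
      using elim by (auto simp: push_def subtree_def suffix_Cons split: if_splits)
    then show ?case
      using prob_law[OF assms, of ?t] by (simp add: pushed_def point_def)
  qed
  then show "(\<lambda>n. pushed S x n i) \<longlonglongrightarrow> x i" by (rule tendsto_eventually)
qed

lemma har_pushed: "har \<Phi> (pushed S x n) = (\<integral>\<^sup>+s. ennreal (\<Phi> (push S n s)) \<partial>measure_pmf (law x))"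
  by (simp add: har_def pushed_def)

lemma har_add:
  assumes "\<And>s. 0 \<le> \<Phi> s" "\<And>s. 0 \<le> \<Psi> s"
  shows "har (\<lambda>s. \<Phi> s + \<Psi> s) x = har \<Phi> x + har \<Psi> x"
  unfolding har_def using assms by (simp add: ennreal_plus nn_integral_add)

lemma har_mono:
  assumes "x \<in> tree_simplex" "\<And>s. s \<in> Tr \<Longrightarrow> \<Phi> s \<le> \<Psi> s"
  shows "har \<Phi> x \<le> har \<Psi> x"
  unfolding har_def using simplex_law(1)[OF assms(1)] assms(2)
  by (intro nn_integral_mono_AE) (auto simp: AE_measure_pmf_iff ennreal_leI)

end

section \<open>The sequence of functions given by a weight on the nodes\<close>
lemma accum_zero:
  assumes "{..<\<gamma>} = {}"
  shows "accum X h \<gamma> x = 0"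
  by (subst accum.simps) (simp add: assms)

lemma accum_successor:
  assumes "\<beta> < \<gamma>" "\<And>\<xi>. \<xi> < \<gamma> \<Longrightarrow> \<xi> \<le> \<beta>"
  shows "accum X h \<gamma> x = lim (\<lambda>k. usc_envelope X (\<lambda>y. accum X h \<beta> y + tail h k y) x)"
proof -
  have "(GREATEST \<beta>. \<beta> < \<gamma>) = \<beta>" using assms by (intro Greatest_equality) auto
  moreover have "{..<\<gamma>} \<noteq> {}" "\<exists>\<beta><\<gamma>. \<forall>\<xi><\<gamma>. \<xi> \<le> \<beta>" using assms by auto
  ultimately show ?thesis by (subst accum.simps) simp
qed

lemma accum_limit:
  assumes "{..<\<gamma>} \<noteq> {}" "\<not> (\<exists>\<beta><\<gamma>. \<forall>\<xi><\<gamma>. \<xi> \<le> \<beta>)"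
  shows "accum X h \<gamma> x = usc_envelope X (\<lambda>y. SUP \<beta>\<in>{..<\<gamma>}. accum X h \<beta> y) x"
  by (subst accum.simps) (simp only: assms if_False)

lemma wellorder_cases [case_names zero successor limit]:
  fixes \<gamma> :: "'o::wellorder"
  assumes "{..<\<gamma>} = {} \<Longrightarrow> P"
    and "\<And>\<beta>. \<beta> < \<gamma> \<Longrightarrow> (\<And>\<xi>. \<xi> < \<gamma> \<Longrightarrow> \<xi> \<le> \<beta>) \<Longrightarrow> P"
    and "{..<\<gamma>} \<noteq> {} \<Longrightarrow> \<not> (\<exists>\<beta><\<gamma>. \<forall>\<xi><\<gamma>. \<xi> \<le> \<beta>) \<Longrightarrow> P"
  shows P
  using assms by blast

text \<open>
  The bumps \<open>b\<close> are the increments of \<open>H\<close>: passing from \<open>H k\<close> to \<open>H (Suc k)\<close> adds the bump of the node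
  with code \<open>k\<close>.
\<close>
locale bumped_tree = wf_tree +
  fixes b :: "nat list \<Rightarrow> real" and B :: real
  assumes b_nonneg: "0 \<le> b s" and b_le: "b s \<le> B"
begin

definition b_head :: "nat \<Rightarrow> nat list \<Rightarrow> real" where
  "b_head k s = (if list_encode s < k then b s else 0)"

definition b_tail :: "nat \<Rightarrow> nat list \<Rightarrow> real" where
  "b_tail k s = (if list_encode s < k then 0 else b s)"

definition H :: "nat \<Rightarrow> (nat \<Rightarrow> real) \<Rightarrow> ennreal" where
  "H k = har (b_head k)"

lemma B_nonneg: "0 \<le> B"
  using b_nonneg b_le by (rule order_trans)

lemma b_head_tail [simp]: "0 \<le> b_head k s" "b_head k s \<le> B" "0 \<le> b_tail k s" "b_tail k s \<le> b s" "b_tail k s \<le> B"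
  using b_nonneg b_le B_nonneg by (auto simp: b_head_def b_tail_def)

text \<open>
  The codes of the descendants of \<open>n # s\<close> exceed \<open>n\<close>.
\<close>
lemma usc_tree_finite_support:
  assumes "\<And>s. k \<le> list_encode s \<Longrightarrow> \<Phi> s = 0" "\<And>s. 0 \<le> \<Phi> s"
  shows "usc_tree \<Phi>"
  unfolding usc_tree_def
proof (intro ballI allI impI)
  fix s and \<epsilon> :: real assume "0 < \<epsilon>"
  show "\<exists>N. \<forall>n\<ge>N. \<forall>t\<in>Tr. t \<in> subtree (n # s) \<longrightarrow> \<Phi> t \<le> \<Phi> s + \<epsilon>"
  proof (intro exI[of _ k] allI impI ballI)
    fix n t assume "k \<le> n" "t \<in> subtree (n # s)"
    then have "n < list_encode t" by (intro less_list_encode) (auto simp: subtree_def suffix_def)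
    then have "\<Phi> t = 0" using assms(1) \<open>k \<le> n\<close> by auto
    then show "\<Phi> t \<le> \<Phi> s + \<epsilon>" using assms(2)[of s] \<open>0 < \<epsilon>\<close> by auto
  qed
qed

lemma usc_H: "usc X (H k)"
  unfolding H_def
  by (intro usc_har[of _ B] usc_tree_finite_support[of k]) (auto simp: b_head_def b_nonneg b_le B_nonneg)

lemma har_finite: "(\<And>s. \<Phi> s \<le> C) \<Longrightarrow> har \<Phi> x < \<top>"
  using har_le[of \<Phi> C x] by (simp add: order_le_less_trans)

lemma usc_H_diff: "usc X (\<lambda>x. H (Suc k) x - H k x)"
proof -
  define \<Phi> where "\<Phi> s = (if list_encode s = k then b s else 0)" for s
  have nonneg: "0 \<le> \<Phi> s" for s by (simp add: \<Phi>_def b_nonneg)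
  have "b_head (Suc k) = (\<lambda>s. b_head k s + \<Phi> s)" by (auto simp: b_head_def \<Phi>_def fun_eq_iff)
  then have "H (Suc k) x = H k x + har \<Phi> x" for x
    unfolding H_def by (simp add: har_add nonneg)
  moreover have "H k x < \<top>" for x unfolding H_def by (rule har_finite[of _ B]) simp
  ultimately have "H (Suc k) x - H k x = har \<Phi> x" for x
    by (simp add: less_top)
  moreover have "usc X (har \<Phi>)"
    by (intro usc_har[of _ B] usc_tree_finite_support[of "Suc k"]) (auto simp: \<Phi>_def b_nonneg b_le B_nonneg)
  ultimately show ?thesis by simp
qed

lemma har_b_split: "har b x = H k x + har (b_tail k) x"
proof -
  have "har b x = har (\<lambda>s. b_head k s + b_tail k s) x"
    by (rule arg_cong[where f = "\<lambda>\<Phi>. har \<Phi> x"]) (auto simp: b_head_def b_tail_def)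
  also have "\<dots> = H k x + har (b_tail k) x"
    unfolding H_def by (rule har_add) simp_all
  finally show ?thesis .
qed

lemma H_mono: "k \<le> l \<Longrightarrow> H k x \<le> H l x"
  unfolding H_def har_def by (intro nn_integral_mono ennreal_leI) (auto simp: b_head_def b_nonneg)

lemma H_tendsto: "(\<lambda>k. H k x) \<longlonglongrightarrow> har b x"
  unfolding H_def har_def
proof (rule nn_integral_LIMSEQ)
  show "incseq (\<lambda>k s. ennreal (b_head k s))"
    by (intro incseq_SucI le_funI ennreal_leI) (auto simp: b_head_def b_nonneg)
  fix s
  have "eventually (\<lambda>k. ennreal (b_head k s) = ennreal (b s)) sequentially"
    using eventually_gt_at_top[of "list_encode s"] by eventually_elim (simp add: b_head_def)
  then show "(\<lambda>k. ennreal (b_head k s)) \<longlonglongrightarrow> ennreal (b s)" by (rule tendsto_eventually)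
qed simp

lemma H_finite: "H k x < \<top>"
  unfolding H_def by (rule har_finite[of _ B]) simp

lemma tail_H: "tail H k x = har (b_tail k) x"
proof -
  have "lim (\<lambda>j. H j x) = har b x" using H_tendsto by (rule limI)
  then show ?thesis using har_b_split[of x k] H_finite[of k x] by (simp add: tail_def less_top)
qed

lemma tail_tendsto: "(\<lambda>k. har (b_tail k) x) \<longlonglongrightarrow> 0"
proof -
  have fin: "har b x < \<top>" by (rule har_finite[of _ B]) (rule b_le)
  have "(\<lambda>k. har b x - H k x) \<longlonglongrightarrow> har b x - har b x"
    using fin by (intro tendsto_diff_ennreal tendsto_const H_tendsto) (auto simp: less_top)
  moreover have "har b x - H k x = har (b_tail k) x" for k
    using har_b_split[of x k] H_finite[of k x] by (simp add: less_top)
  ultimately show ?thesis using fin by (simp add: less_top)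
qed

lemma accum_successor_H:
  assumes "\<beta> < \<gamma>" "\<And>\<xi>. \<xi> < \<gamma> \<Longrightarrow> \<xi> \<le> \<beta>"
  shows "accum X H \<gamma> x = (INF k. usc_envelope X (\<lambda>y. accum X H \<beta> y + har (b_tail k) y) x)"
proof -
  have "decseq (\<lambda>k. usc_envelope X (\<lambda>y. accum X H \<beta> y + har (b_tail k) y) x)"
  proof (rule decseq_SucI, rule envelope_mono, rule add_left_mono)
    show "har (b_tail (Suc k)) y \<le> har (b_tail k) y" if "y \<in> tree_simplex" for k y
      using that by (intro har_mono) (auto simp: b_tail_def b_nonneg)
  qed
  then have "lim (\<lambda>k. usc_envelope X (\<lambda>y. accum X H \<beta> y + har (b_tail k) y) x) =
      (INF k. usc_envelope X (\<lambda>y. accum X H \<beta> y + har (b_tail k) y) x)"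
    by (intro limI LIMSEQ_INF)
  moreover have "accum X H \<gamma> x = lim (\<lambda>k. usc_envelope X (\<lambda>y. accum X H \<beta> y + tail H k y) x)"
    using assms by (rule accum_successor)
  ultimately show ?thesis
    unfolding tail_H by (rule trans[rotated])
qed

section \<open>Two-sided bounds for the order of accumulation\<close>

text \<open>
  In the successor step the tail contributes the bumps with code at least \<open>k\<close>, and the functions
  \<open>\<Psi>\<close> below are upper semicontinuous majorants that decrease to \<open>\<Phi> \<gamma>\<close> as \<open>k\<close> grows.  Bumps are not
  upper semicontinuous at the nodes they accumulate at; the assumption on \<open>b (n # s)\<close> says that
  \<open>\<Phi> \<gamma>\<close> anticipates the bump at the parent, which is again close to the node in question.
\<close>
lemma accum_le:
  fixes \<Phi> :: "'o::wellorder \<Rightarrow> nat list \<Rightarrow> real"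
  assumes nonneg: "\<And>\<gamma> s. 0 \<le> \<Phi> \<gamma> s" and bounded: "\<And>\<gamma> s. \<Phi> \<gamma> s \<le> C"
    and usc: "\<And>\<gamma>. usc_tree (\<Phi> \<gamma>)"
    and mono: "\<And>\<beta> \<gamma> s. \<beta> < \<gamma> \<Longrightarrow> s \<in> Tr \<Longrightarrow> \<Phi> \<beta> s \<le> \<Phi> \<gamma> s"
    and bump: "\<And>\<beta> \<gamma> n s. \<beta> < \<gamma> \<Longrightarrow> n # s \<in> Tr \<Longrightarrow> \<Phi> \<beta> (n # s) + b (n # s) \<le> max (\<Phi> \<gamma> (n # s)) (\<Phi> \<gamma> s)"
    and x: "x \<in> tree_simplex"
  shows "accum X H \<gamma> x \<le> har (\<Phi> \<gamma>) x"
  using x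
proof (induction \<gamma> arbitrary: x rule: less_induct)
  case (less \<gamma>)
  note IH = less.IH
  show ?case
  proof (cases \<gamma> rule: wellorder_cases)
    case zero
    then show ?thesis by (simp add: accum_zero)
  next
    case limit
    have "accum X H \<beta> y \<le> har (\<Phi> \<gamma>) y" if "\<beta> < \<gamma>" "y \<in> tree_simplex" for \<beta> y
      using IH[OF that] har_mono[OF that(2), of "\<Phi> \<beta>" "\<Phi> \<gamma>"] mono[OF that(1)] by (auto intro: order_trans)
    then show ?thesis
      unfolding accum_limit[OF limit]
      by (intro envelope_le_har[OF usc nonneg bounded less.prems] SUP_least) auto
  next
    case (successor \<beta>)
    have "(INF k. usc_envelope X (\<lambda>y. accum X H \<beta> y + har (b_tail k) y) x) \<le> har (\<Phi> \<gamma>) x + har (b_tail k) x" for k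
    proof -
      define \<Psi> where "\<Psi> s = max (\<Phi> \<gamma> s) (\<Phi> \<beta> s + b_tail k s)" for s
      have \<Psi>: "0 \<le> \<Psi> s" "\<Psi> s \<le> C + B" for s
        using nonneg[of \<gamma> s] bounded[of \<gamma> s] bounded[of \<beta> s] B_nonneg b_head_tail(5)[of k s]
        unfolding \<Psi>_def by linarith+
      have "usc_tree \<Psi>"
        unfolding usc_tree_def
      proof (intro ballI allI impI)
        fix s and \<epsilon> :: real assume s: "s \<in> Tr" "0 < \<epsilon>"
        then obtain N where N: "\<And>n t. N \<le> n \<Longrightarrow> t \<in> Tr \<Longrightarrow> t \<in> subtree (n # s) \<Longrightarrow> \<Phi> \<gamma> t \<le> \<Phi> \<gamma> s + \<epsilon>"
          using usc[of \<gamma>] unfolding usc_tree_def by meson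
        show "\<exists>N. \<forall>n\<ge>N. \<forall>t\<in>Tr. t \<in> subtree (n # s) \<longrightarrow> \<Psi> t \<le> \<Psi> s + \<epsilon>"
        proof (intro exI[of _ N] allI impI ballI)
          fix n t assume t: "N \<le> n" "t \<in> Tr" "t \<in> subtree (n # s)"
          then obtain m t' where t': "t = m # t'" by (cases t) (auto simp: subtree_def)
          have "t' = s \<or> t' \<in> subtree (n # s)" using t(3) by (auto simp: t' subtree_def suffix_Cons)
          then have "\<Phi> \<gamma> t' \<le> \<Phi> \<gamma> s + \<epsilon>" using N[OF t(1)] t(2) parent s by (auto simp: t')
          moreover have "\<Phi> \<gamma> t \<le> \<Phi> \<gamma> s + \<epsilon>" using N[OF t] .
          moreover have "\<Phi> \<beta> t + b t \<le> max (\<Phi> \<gamma> t) (\<Phi> \<gamma> t')"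
            using bump[OF successor(1)] t(2) by (auto simp: t')
          moreover have "b_tail k t \<le> b t" by simp
          ultimately show "\<Psi> t \<le> \<Psi> s + \<epsilon>" unfolding \<Psi>_def by linarith
        qed
      qed
      moreover have "accum X H \<beta> y + har (b_tail k) y \<le> har \<Psi> y" if "y \<in> tree_simplex" for y
      proof -
        have "accum X H \<beta> y + har (b_tail k) y \<le> har (\<Phi> \<beta>) y + har (b_tail k) y"
          using IH[OF successor(1) that] by (rule add_right_mono)
        also have "\<dots> = har (\<lambda>s. \<Phi> \<beta> s + b_tail k s) y" by (simp add: har_add nonneg)
        also have "\<dots> \<le> har \<Psi> y" using that by (intro har_mono) (auto simp: \<Psi>_def)
        finally show ?thesis .
      qed
      ultimately have "usc_envelope X (\<lambda>y. accum X H \<beta> y + har (b_tail k) y) x \<le> har \<Psi> x"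
        by (intro envelope_le_har[OF _ \<Psi> less.prems])
      also have "\<dots> \<le> har (\<lambda>s. \<Phi> \<gamma> s + b_tail k s) x"
        using less.prems mono[OF successor(1)] by (intro har_mono) (auto simp: \<Psi>_def)
      also have "\<dots> = har (\<Phi> \<gamma>) x + har (b_tail k) x" by (simp add: har_add nonneg)
      finally show ?thesis by (rule INF_lower2[OF UNIV_I])
    qed
    moreover have "(\<lambda>k. har (\<Phi> \<gamma>) x + har (b_tail k) x) \<longlonglongrightarrow> har (\<Phi> \<gamma>) x + 0"
      by (intro tendsto_add tendsto_const tail_tendsto)
    ultimately have "(INF k. usc_envelope X (\<lambda>y. accum X H \<beta> y + har (b_tail k) y) x) \<le> har (\<Phi> \<gamma>) x + 0"
      by (intro LIMSEQ_le_const) auto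
    moreover have "accum X H \<gamma> x = (INF k. usc_envelope X (\<lambda>y. accum X H \<beta> y + har (b_tail k) y) x)"
      using successor by (rule accum_successor_H)
    ultimately show ?thesis by simp
  qed
qed

text \<open>
  The assumptions say that the value \<open>\<Lambda> \<gamma> s\<close> can be reached, up to a change of the clock, at the \<open>n\<close>-th
  child for every \<open>n\<close>, with the bump in the successor case and without it in the limit case.  Pushing the
  mass of all such nodes to their \<open>n\<close>-th children transfers this to arbitrary points of the simplex.
\<close>
lemma accum_ge:
  fixes \<Lambda> :: "'o::wellorder \<Rightarrow> nat list \<Rightarrow> real"
  assumes nonneg: "\<And>\<gamma> s. 0 \<le> \<Lambda> \<gamma> s"
    and mono: "\<And>\<beta> \<gamma> s. \<beta> < \<gamma> \<Longrightarrow> s \<in> Tr \<Longrightarrow> \<Lambda> \<beta> s \<le> \<Lambda> \<gamma> s"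
    and zero: "\<And>\<gamma> s. {..<\<gamma>} = {} \<Longrightarrow> s \<in> Tr \<Longrightarrow> \<Lambda> \<gamma> s = 0"
    and succ: "\<And>\<beta> \<gamma> s. \<beta> < \<gamma> \<Longrightarrow> (\<And>\<xi>. \<xi> < \<gamma> \<Longrightarrow> \<xi> \<le> \<beta>) \<Longrightarrow> s \<in> Tr \<Longrightarrow>
      \<Lambda> \<gamma> s = 0 \<or> (\<forall>n. n # s \<in> Tr \<and> \<Lambda> \<gamma> s \<le> \<Lambda> \<beta> (n # s) + b (n # s))"
    and lim: "\<And>\<gamma> s. \<not> (\<exists>\<beta><\<gamma>. \<forall>\<xi><\<gamma>. \<xi> \<le> \<beta>) \<Longrightarrow> s \<in> Tr \<Longrightarrow>
      \<Lambda> \<gamma> s = 0 \<or> (\<exists>\<beta><\<gamma>. \<Lambda> \<gamma> s \<le> \<Lambda> \<beta> s) \<or> (\<forall>n. n # s \<in> Tr \<and> (\<exists>\<beta><\<gamma>. \<Lambda> \<gamma> s \<le> \<Lambda> \<beta> (n # s)))"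
    and x: "x \<in> tree_simplex"
  shows "har (\<Lambda> \<gamma>) x \<le> accum X H \<gamma> x"
  using x
proof (induction \<gamma> arbitrary: x rule: less_induct)
  case (less \<gamma>)
  note IH = less.IH and x = less.prems
  have supp: "AE s in measure_pmf (law x). s \<in> Tr"
    using simplex_law(1)[OF x] by (auto simp: AE_measure_pmf_iff)
  show ?case
  proof (cases \<gamma> rule: wellorder_cases)
    case zero
    then have "har (\<Lambda> \<gamma>) x \<le> har (\<lambda>_. 0) x" using x assms(3) by (intro har_mono) auto
    then show ?thesis by (simp add: har_def)
  next
    case (successor \<beta>)
    define S where "S = {s \<in> Tr. \<forall>n. n # s \<in> Tr}"
    have in_simplex: "pushed S x n \<in> tree_simplex" for n
      using x by (rule pushed_in_simplex) (auto simp: S_def)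
    have "har (\<Lambda> \<gamma>) x \<le> usc_envelope X (\<lambda>y. accum X H \<beta> y + har (b_tail k) y) x" for k
    proof (rule envelope_ge_limit[OF pushed_tendsto[OF x] in_simplex x])
      show "eventually (\<lambda>n. har (\<Lambda> \<gamma>) x \<le> accum X H \<beta> (pushed S x n) + har (b_tail k) (pushed S x n)) sequentially"
        using eventually_ge_at_top[of k]
      proof eventually_elim
        case (elim n)
        have "\<Lambda> \<gamma> s \<le> \<Lambda> \<beta> (push S n s) + b_tail k (push S n s)" if "s \<in> Tr" for s
          using succ[OF successor that]
        proof
          assume *: "\<forall>n. n # s \<in> Tr \<and> \<Lambda> \<gamma> s \<le> \<Lambda> \<beta> (n # s) + b (n # s)"
          \<comment> \<open>The bumps of the \<open>n\<close>-th children all belong to the tail, since \<open>n \<ge> k\<close>.\<close>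
          then have "push S n s = n # s" using that by (auto simp: push_def S_def)
          moreover have "k \<le> list_encode (n # s)"
            using elim less_list_encode[of n "n # s"] by simp
          ultimately show ?thesis using * by (simp add: b_tail_def)
        next
          assume "\<Lambda> \<gamma> s = 0"
          then show ?thesis using nonneg[of \<beta> "push S n s"] by simp
        qed
        then have "har (\<Lambda> \<gamma>) x \<le> (\<integral>\<^sup>+s. ennreal (\<Lambda> \<beta> (push S n s) + b_tail k (push S n s)) \<partial>measure_pmf (law x))"
          unfolding har_def using supp by (intro nn_integral_mono_AE) (auto elim!: eventually_mono intro: ennreal_leI)
        also have "\<dots> = har (\<Lambda> \<beta>) (pushed S x n) + har (b_tail k) (pushed S x n)"
          unfolding har_pushed by (simp add: ennreal_plus nonneg nn_integral_add)
        also have "\<dots> \<le> accum X H \<beta> (pushed S x n) + har (b_tail k) (pushed S x n)"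
          by (intro add_right_mono IH successor in_simplex)
        finally show ?case .
      qed
    qed
    then have "har (\<Lambda> \<gamma>) x \<le> (INF k. usc_envelope X (\<lambda>y. accum X H \<beta> y + har (b_tail k) y) x)"
      by (intro INF_greatest)
    also have "\<dots> = accum X H \<gamma> x"
      using successor by (rule accum_successor_H[symmetric])
    finally show ?thesis .
  next
    case limit
    define S where "S = {s \<in> Tr. (\<forall>n. n # s \<in> Tr) \<and> \<not> (\<exists>\<beta><\<gamma>. \<Lambda> \<gamma> s \<le> \<Lambda> \<beta> s)}"
    have in_simplex: "pushed S x n \<in> tree_simplex" for n
      using x by (rule pushed_in_simplex) (auto simp: S_def)
    obtain \<beta>0 where \<beta>0: "\<beta>0 < \<gamma>" using limit(1) by auto
    have "har (\<Lambda> \<gamma>) x \<le> usc_envelope X (\<lambda>y. SUP \<beta>\<in>{..<\<gamma>}. accum X H \<beta> y) x"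
      unfolding har_def[of "\<Lambda> \<gamma>"] nn_integral_pmf_suminf
    proof (intro suminf_le_if_sums_le envelope_ge_limit[OF pushed_tendsto[OF x] in_simplex x] always_eventually allI)
      fix N n
      let ?w = "\<lambda>i. ennreal (pmf (law x) (list_decode i))"
      have "\<exists>\<beta><\<gamma>. \<Lambda> \<gamma> s \<le> \<Lambda> \<beta> (push S n s)" if "s \<in> Tr" for s
      proof (cases "s \<in> S")
        case True
        then show ?thesis using lim[OF limit(2) that] nonneg \<beta>0 by (auto simp: S_def push_def)
      next
        case False
        then show ?thesis using lim[OF limit(2) that] nonneg \<beta>0 that by (auto simp: S_def push_def)
      qed
      then obtain \<beta> where \<beta>: "\<And>s. s \<in> Tr \<Longrightarrow> \<beta> s < \<gamma> \<and> \<Lambda> \<gamma> s \<le> \<Lambda> (\<beta> s) (push S n s)" by metis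
      \<comment> \<open>The earlier clock depends on the node; one clock serves finitely many nodes, and finite sums suffice.\<close>
      define \<xi> where "\<xi> = Max (insert \<beta>0 (\<beta> ` ({list_decode i |i. i < N} \<inter> Tr)))"
      have fin: "finite (insert \<beta>0 (\<beta> ` ({list_decode i |i. i < N} \<inter> Tr)))" by auto
      have \<xi>: "\<xi> < \<gamma>" unfolding \<xi>_def using fin \<beta> \<beta>0 by (subst Max_less_iff) auto
      have "(\<Sum>i<N. ennreal (\<Lambda> \<gamma> (list_decode i)) * ?w i) \<le> (\<Sum>i<N. ennreal (\<Lambda> \<xi> (push S n (list_decode i))) * ?w i)"
      proof (rule sum_mono)
        fix i assume i: "i \<in> {..<N}"
        let ?s = "list_decode i"
        show "ennreal (\<Lambda> \<gamma> ?s) * ?w i \<le> ennreal (\<Lambda> \<xi> (push S n ?s)) * ?w i"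
        proof (cases "?s \<in> Tr")
          case True
          then have "\<beta> ?s \<le> \<xi>" unfolding \<xi>_def using fin i by (intro Max_ge) auto
          moreover have "push S n ?s \<in> Tr" using True by (auto simp: push_def S_def)
          ultimately have "\<Lambda> (\<beta> ?s) (push S n ?s) \<le> \<Lambda> \<xi> (push S n ?s)"
            using mono[of "\<beta> ?s" \<xi>] by (cases "\<beta> ?s = \<xi>") auto
          then show ?thesis using \<beta>[OF True] by (intro mult_right_mono ennreal_leI) auto
        next
          case False
          then have "pmf (law x) ?s = 0" using simplex_law(1)[OF x] by (auto simp: set_pmf_eq)
          then show ?thesis by simp
        qed
      qed
      also have "\<dots> \<le> har (\<Lambda> \<xi>) (pushed S x n)"
        unfolding har_pushed by (rule sum_le_nn_integral_pmf)
      also have "\<dots> \<le> accum X H \<xi> (pushed S x n)" by (intro IH \<xi> in_simplex)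
      also have "\<dots> \<le> (SUP \<beta>\<in>{..<\<gamma>}. accum X H \<beta> (pushed S x n))" using \<xi> by (intro SUP_upper) auto
      finally show "(\<Sum>i<N. ennreal (\<Lambda> \<gamma> (list_decode i)) * ?w i) \<le> (SUP \<beta>\<in>{..<\<gamma>}. accum X H \<beta> (pushed S x n))" .
    qed
    then show ?thesis unfolding accum_limit[OF limit] .
  qed
qed

end

section \<open>The tree of all plays of the hydra game\<close>
locale hydra_tree = hydra +
  fixes start :: "'a state"
  assumes good_start: "good start" and budgets_pos: "\<And>x. x \<in> set start \<Longrightarrow> 0 < snd x"
begin

text \<open>
  The number of pieces grows with all branch numbers on the path, so that it is at least \<open>n\<close> everywhere
  in the subtree of \<open>n # s\<close>, and it is never zero.
\<close>
fun state :: "nat list \<Rightarrow> 'a state" where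
  "state [] = start"
| "state (n # s) = step (Suc (n + sum_list s)) (state s)"

fun live :: "nat list \<Rightarrow> bool" where
  "live [] \<longleftrightarrow> True"
| "live (n # s) \<longleftrightarrow> live s \<and> state s \<noteq> []"

fun bump :: "nat list \<Rightarrow> real" where
  "bump [] = 0"
| "bump (n # s) = (if state s \<noteq> [] \<and> fst (hd (state s)) = zero_elt then snd (hd (state s)) else 0)"

abbreviation value_at :: "nat list \<Rightarrow> real" where
  "value_at s \<equiv> budget (mset (state s))"

lemma reach_state: "reach 1 start (state s)"
  by (induction s) (auto intro: reach.intros)

lemma good_state: "good (state s)"
  using reach_good[OF reach_state good_start] .

lemma budget_nonneg_state: "x \<in> set (state s) \<Longrightarrow> 0 \<le> snd x"
  using good_state[of s] by (auto simp: good_def)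

lemma value_at_nonneg: "0 \<le> value_at s"
  by (rule budget_nonneg) (simp add: budget_nonneg_state)

lemma value_at_le: "value_at s \<le> value_at []"
  using reach_budget[OF reach_state _ good_start, of s] by simp

lemma value_at_Cons: "state s \<noteq> [] \<Longrightarrow> value_at s = value_at (n # s) + bump (n # s)"
  using budget_step[of "state s" "Suc (n + sum_list s)"] by simp

lemma rank_Cons_less: "state s \<noteq> [] \<Longrightarrow> rank (state (n # s)) < rank (state s)"
  by (simp add: rank_step_less)

lemma rank_le_start: "rank (state s) \<le> rank start"
proof (induction s)
  case (Cons n s)
  show ?case
  proof (cases "state s = []")
    case True
    then show ?thesis by (simp add: rank_def)
  next
    case False
    then show ?thesis using rank_Cons_less[OF False, of n] Cons by (simp del: state.simps)
  qed
qed simp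

lemma reach_subtree:
  assumes "N \<le> n" "t \<in> subtree (n # s)"
  shows "reach N (state s) (state t)"
proof -
  obtain u where t: "t = u @ n # s" using assms(2) by (auto simp: subtree_def suffix_def)
  show ?thesis unfolding t using assms(1) by (induction u) (auto intro!: reach.intros)
qed

lemma bump_nonneg: "0 \<le> bump s"
  by (cases s) (auto intro!: budget_nonneg_state hd_in_set)

lemma bump_le: "bump s \<le> value_at []"
proof (cases s)
  case (Cons n t)
  show ?thesis
  proof (cases "state t = []")
    case False
    then have "bump s \<le> value_at t" using value_at_Cons[OF False, of n] value_at_nonneg[of s] Cons by simp
    then show ?thesis using value_at_le[of t] by simp
  qed (use value_at_nonneg[of "[]"] Cons in simp)
qed (use value_at_nonneg[of "[]"] in simp)

sublocale bumped_tree "{s. live s}" bump "value_at []"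
proof
  show "wf {(n # s, s) |n s. n # s \<in> {s. live s}}"
  proof (rule wf_subset)
    show "wf (inv_image {(M, N). M < N} (\<lambda>s. rank (state s)))" by (intro wf_inv_image wf)
    show "{(n # s, s) |n s. n # s \<in> {s. live s}} \<subseteq> inv_image {(M, N). M < N} (\<lambda>s. rank (state s))"
      using rank_Cons_less by (auto simp del: state.simps)
  qed
qed (auto simp: bump_nonneg bump_le simp del: bump.simps state.simps)

lemma usc_tree_gain: "usc_tree (\<lambda>s. gain (state s) C)"
  unfolding usc_tree_def
proof (intro ballI allI impI)
  fix s and \<epsilon> :: real assume "0 < \<epsilon>"
  then obtain N where "\<And>N' t. N \<le> N' \<Longrightarrow> reach N' (state s) t \<Longrightarrow> gain t C \<le> gain (state s) C + \<epsilon>"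
    using gain_upper_semicontinuous[OF good_state[of s], of \<epsilon> C] by blast
  then show "\<exists>N. \<forall>n\<ge>N. \<forall>t\<in>{s. live s}. t \<in> subtree (n # s) \<longrightarrow> gain (state t) C \<le> gain (state s) C + \<epsilon>"
    using reach_subtree by blast
qed

text \<open>
  The bump of a child is paid by the tick from \<open>clock \<beta>\<close> to \<open>clock \<gamma>\<close>, by \<open>gain_step_zero\<close>.
\<close>
lemma accum_le_gain:
  assumes "x \<in> tree_simplex"
  shows "accum X H \<gamma> x \<le> har (\<lambda>s. gain (state s) (clock \<gamma>)) x"
proof (rule accum_le[where C = "value_at []"])
  show "gain (state s) (clock \<gamma>) \<le> value_at []" for \<gamma> s
    using gain_le_budget[of "state s" "clock \<gamma>"] budget_nonneg_state value_at_le[of s] by (meson order_trans)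
  fix \<beta> \<gamma> :: 'a assume less: "\<beta> < \<gamma>"
  then have le: "clock \<beta> \<le> clock \<gamma>" by simp
  then show "gain (state s) (clock \<beta>) \<le> gain (state s) (clock \<gamma>)" for s by (rule gain_mono)
  fix n s
  show "gain (state (n # s)) (clock \<beta>) + bump (n # s)
      \<le> max (gain (state (n # s)) (clock \<gamma>)) (gain (state s) (clock \<gamma>))"
  proof (cases "bump (n # s) = 0")
    case True
    then show ?thesis using gain_mono[OF le, of "state (n # s)"] by simp
  next
    case False
    then have "state s \<noteq> []" "fst (hd (state s)) = zero_elt" by (auto split: if_splits)
    then show ?thesis
      using gain_step_zero[of "state s" "clock \<beta>" "clock \<gamma>" "Suc (n + sum_list s)"] add_zero_elt_le[of "clock \<beta>" "clock \<gamma>"] less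
      by simp
  qed
qed (auto intro: gain_nonneg usc_tree_gain assms)

text \<open>
  The rank decreases in every move, so a clock that has reached the rank of a node can always be set to
  the rank of a child.  If a limit clock shows exactly the rank of \<open>s\<close>, then the first block of \<open>s\<close> has a
  positive exponent, and the move to a child forfeits no bump.
\<close>
lemma accum_ge_value:
  assumes "x \<in> tree_simplex"
  shows "har (\<lambda>s. if rank (state s) \<le> clock \<gamma> then value_at s else 0) x \<le> accum X H \<gamma> x"
proof (rule accum_ge[where \<Lambda> = "\<lambda>\<gamma> s. if rank (state s) \<le> clock \<gamma> then value_at s else 0"])
  show "0 \<le> (if rank (state s) \<le> clock \<gamma> then value_at s else 0)" for \<gamma> s
    by (simp add: value_at_nonneg)
  show "(if rank (state s) \<le> clock \<beta> then value_at s else 0) \<le> (if rank (state s) \<le> clock \<gamma> then value_at s else 0)"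
    if "\<beta> < \<gamma>" for \<beta> \<gamma> s
    using clock_strict_mono[OF that] value_at_nonneg[of s] by (auto intro: order_trans)
  fix \<gamma> :: 'a and s assume "s \<in> {s. live s}"
  then have live: "live s" by simp
  have child: "\<exists>\<beta><\<gamma>. rank (state (n # s)) = clock \<beta>" if "state s \<noteq> []" "rank (state s) \<le> clock \<gamma>" for n \<gamma>
    using order_less_le_trans[OF rank_Cons_less that(2)] that by (meson less_clockE)
  let ?\<Lambda> = "\<lambda>\<gamma> s. if rank (state s) \<le> clock \<gamma> then value_at s else 0"
  show "?\<Lambda> \<gamma> s = 0" if "{..<\<gamma>} = {}"
    using child[of \<gamma>] that by (cases "state s = []") auto
  show "?\<Lambda> \<gamma> s = 0 \<or> (\<forall>n. n # s \<in> {s. live s} \<and> ?\<Lambda> \<gamma> s \<le> ?\<Lambda> \<beta> (n # s) + bump (n # s))"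
    if \<beta>: "\<beta> < \<gamma>" "\<And>\<xi>. \<xi> < \<gamma> \<Longrightarrow> \<xi> \<le> \<beta>" for \<beta>
  proof (cases "state s \<noteq> [] \<and> rank (state s) \<le> clock \<gamma>")
    case True
    have "rank (state (n # s)) \<le> clock \<beta>" for n
      using child[of \<gamma> n] True \<beta>(2) by (metis clock_le_iff)
    then show ?thesis using True live value_at_Cons[of s] by (simp del: state.simps bump.simps)
  qed auto
  show "?\<Lambda> \<gamma> s = 0 \<or> (\<exists>\<beta><\<gamma>. ?\<Lambda> \<gamma> s \<le> ?\<Lambda> \<beta> s) \<or>
      (\<forall>n. n # s \<in> {s. live s} \<and> (\<exists>\<beta><\<gamma>. ?\<Lambda> \<gamma> s \<le> ?\<Lambda> \<beta> (n # s)))"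
    if lim: "\<not> (\<exists>\<beta><\<gamma>. \<forall>\<xi><\<gamma>. \<xi> \<le> \<beta>)"
  proof (cases "state s \<noteq> [] \<and> rank (state s) \<le> clock \<gamma>")
    case True
    show ?thesis
    proof (cases "rank (state s) < clock \<gamma>")
      case True
      then obtain \<beta> where "\<beta> < \<gamma>" "rank (state s) = clock \<beta>" by (rule less_clockE)
      then show ?thesis by (auto intro!: exI[of _ \<beta>])
    next
      case False
      then have eq: "rank (state s) = clock \<gamma>" using True by simp
      have "fst (hd (state s)) \<noteq> zero_elt"
      proof
        assume "fst (hd (state s)) = zero_elt"
        then have "rank (state s) = add_mset zero_elt (rank (state (0 # s)))"
          using True by (cases "state s") (auto simp: rank_def)
        moreover obtain \<xi> where \<xi>: "\<xi> < \<gamma>" "rank (state (0 # s)) = clock \<xi>"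
          using child[of \<gamma> 0] True by auto
        moreover obtain \<xi>' where "\<xi>' < \<gamma>" "\<xi> < \<xi>'" using lim \<xi>(1) by (meson not_le)
        ultimately show False
          using eq add_zero_elt_le[of "clock \<xi>" "clock \<xi>'"] by (metis clock_less_iff linorder_not_le)
      qed
      then have "bump (n # s) = 0" for n by simp
      then have "value_at s = value_at (n # s)" for n
        using True value_at_Cons[of s n] by simp
      then have "n # s \<in> {s. live s} \<and> (\<exists>\<beta><\<gamma>. ?\<Lambda> \<gamma> s \<le> ?\<Lambda> \<beta> (n # s))" for n
      proof -
        obtain \<beta> where "\<beta> < \<gamma>" "rank (state (n # s)) = clock \<beta>" using child[of \<gamma> n] True by auto
        moreover have "value_at s = value_at (n # s)" by fact
        ultimately show ?thesis using True live by (auto simp del: state.simps intro!: exI[of _ \<beta>])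
      qed
      then show ?thesis by blast
    qed
  qed auto
qed (rule assms)

lemma accum_eq_value:
  assumes "rank start \<le> clock \<gamma>" "x \<in> tree_simplex"
  shows "accum X H \<gamma> x = har value_at x"
proof (rule order_antisym)
  have le: "rank (state s) \<le> clock \<gamma>" for s
    using rank_le_start assms(1) by (rule order_trans)
  then have "gain (state s) (clock \<gamma>) = value_at s" for s
    by (intro gain_eq_budget budget_nonneg_state)
  then show "accum X H \<gamma> x \<le> har value_at x"
    using accum_le_gain[OF assms(2), of \<gamma>] by simp
  show "har value_at x \<le> accum X H \<gamma> x"
    using accum_ge_value[OF assms(2), of \<gamma>] le by simp
qed

lemma har_vertex_root: "har \<Phi> (vertex []) = ennreal (\<Phi> [])"
  by (simp add: har_def vertex_def)

lemma accum_less_value: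
  assumes "clock \<gamma> < rank start"
  shows "accum X H \<gamma> (vertex []) < har value_at (vertex [])"
proof -
  have "accum X H \<gamma> (vertex []) \<le> ennreal (gain start (clock \<gamma>))"
    using accum_le_gain[of "vertex []" \<gamma>] by (simp add: har_vertex_root)
  also have "\<dots> < ennreal (value_at [])"
    using gain_less_budget[OF budgets_pos assms] gain_nonneg by (intro ennreal_lessI) (auto intro: order_le_less_trans)
  finally show ?thesis by (simp add: har_vertex_root)
qed

lemma accumulation_order_eq:
  assumes "rank start = clock \<alpha>"
  shows "accumulation_order X H = \<alpha>"
  unfolding accumulation_order_def
proof (rule Least_equality)
  have *: "accum X H \<beta> x = har value_at x" if "\<alpha> \<le> \<beta>" "x \<in> tree_simplex" for \<beta> x
    using that assms by (intro accum_eq_value) auto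
  show "\<forall>\<beta>\<ge>\<alpha>. \<forall>x\<in>topspace X. accum X H \<beta> x = accum X H \<alpha> x"
    by (simp add: *)
  fix \<gamma> :: 'a assume \<gamma>: "\<forall>\<beta>\<ge>\<gamma>. \<forall>x\<in>topspace X. accum X H \<beta> x = accum X H \<gamma> x"
  show "\<alpha> \<le> \<gamma>"
  proof (rule ccontr)
    assume "\<not> \<alpha> \<le> \<gamma>"
    then have "\<gamma> < \<alpha>" by simp
    then have "accum X H \<gamma> (vertex []) < har value_at (vertex [])"
      using assms by (intro accum_less_value) simp
    moreover have "accum X H \<alpha> (vertex []) = har value_at (vertex [])"
      using assms by (intro accum_eq_value) auto
    moreover have "\<gamma> \<le> \<alpha>" "vertex [] \<in> topspace X" using \<open>\<gamma> < \<alpha>\<close> by auto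
    then have "accum X H \<alpha> (vertex []) = accum X H \<gamma> (vertex [])"
      using \<gamma> by blast
    ultimately show False by (metis less_irrefl)
  qed
qed

end

text \<open>
  Enumerate the ordinals below \<open>\<alpha>\<close> and take the largest ordinal below \<open>d\<close> among the first \<open>N\<close> of them.
  Using one enumeration for all \<open>d\<close> yields the uniformity demanded by \<open>hydra\<close>.
\<close>
lemma ex_fundamental_sequences:
  fixes \<alpha> :: "'o::wellorder"
  assumes "countable {..<\<alpha>}"
  shows "\<exists>fund. hydra fund \<alpha>"
proof -
  define idx where "idx = to_nat_on {..<\<alpha>}"
  have inj: "inj_on idx {..<\<alpha>}" unfolding idx_def using assms by (rule inj_on_to_nat_on)
  define E where "E N d = insert zero_elt {e. e < d \<and> e < \<alpha> \<and> idx e \<le> N}" for N :: nat and d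
  have fin: "finite (E N d)" for N d
  proof -
    have "finite {e \<in> {..<\<alpha>}. idx e \<le> N}"
      by (rule finite_imageD[of idx]) (auto intro: finite_subset[of _ "{..N}"] inj_on_subset[OF inj])
    then show ?thesis unfolding E_def by (auto intro: finite_subset[rotated])
  qed
  have ne: "E N d \<noteq> {}" for N d by (auto simp: E_def)
  have "hydra (\<lambda>N d. Max (E N d)) \<alpha>"
  proof
    show "Max (E N d) < d" if "zero_elt < d" for N d
      using that fin ne by (subst Max_less_iff) (auto simp: E_def)
    show "\<exists>N0. \<forall>N\<ge>N0. \<forall>d. e < d \<and> d \<le> \<alpha> \<longrightarrow> e \<le> Max (E N d)" if "e < \<alpha>" for e
      using that fin by (intro exI[of _ "idx e"] allI impI Max_ge) (auto simp: E_def)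
  qed
  then show ?thesis by blast
qed

theorem theorem1p3:
  fixes \<alpha> :: "'w::infinite ordinal"
  assumes "countable {..<\<alpha>}"
  shows "\<exists>(T :: (nat \<Rightarrow> real) topology) M X (h :: nat \<Rightarrow> (nat \<Rightarrow> real) \<Rightarrow> ennreal).
    metrizable_Choquet_simplex T M \<and> X = subtopology T M \<and>
    (\<forall>k. \<forall>x\<in>M. h k x < \<top> \<and> h k x \<le> h (Suc k) x) \<and>
    (\<forall>k. harmonic X (h k) \<and> usc X (h k)) \<and>
    (\<exists>g. (\<forall>x\<in>M. (\<lambda>k. h k x) \<longlonglongrightarrow> g x) \<and> bounded_on M g) \<and>
    (\<forall>k. usc X (\<lambda>x. h (Suc k) x - h k x)) \<and>
    accumulation_order X h = \<alpha>"
proof -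
  obtain fund where "hydra fund \<alpha>" using ex_fundamental_sequences[OF assms] by blast
  then interpret hydra fund \<alpha> .
  \<comment> \<open>The root is the position of rank \<open>clock \<alpha>\<close> in which every block has budget \<open>1\<close>.\<close>
  define start where "start = map (\<lambda>d. (d, 1::real)) (sorted_list_of_multiset (clock \<alpha>))"
  have "d \<le> \<alpha>" if "d \<in># clock \<alpha>" for d
    using clock_le_single[of \<alpha>] that by (auto simp: mset_le_single_right_iff)
  then interpret hydra_tree fund \<alpha> start
    by unfold_locales (auto simp: good_def start_def comp_def)
  have rank: "rank start = clock \<alpha>"
    by (simp add: rank_def start_def image_mset.compositionality comp_def)
  have "bounded_on tree_simplex (har bump)"
    unfolding bounded_on_def using har_le[of bump, OF bump_le] by blast
  then have "\<exists>g. (\<forall>x\<in>tree_simplex. (\<lambda>k. H k x) \<longlonglongrightarrow> g x) \<and> bounded_on tree_simplex g"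
    using H_tendsto by blast
  moreover have "harmonic X (H k)" for k unfolding H_def by (rule harmonic_har)
  ultimately show ?thesis
    using metrizable_Choquet_simplex H_finite H_mono[of _ "Suc _"] usc_H usc_H_diff accumulation_order_eq[OF rank]
    by (intro exI[of _ euclidean] exI[of _ tree_simplex] exI[of _ X] exI[of _ H]) auto
qed

end
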